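(* For $d=1,2,3,4$ let $\mathcal{O}_d=\mathcal{O}(G^+(\mathcal{G}'_d,\mathcal{G}_d))$ be the bigalois extension from $\mathcal{G}'_d=(\mathbb{C}^4,\tau_{\mathbb{C}^4},A'_d)$ to $\mathcal{G}_d=(M_2,\tau,A_d)$. Then $\mathcal{O}_1=\mathcal{O}_4$ is the universal unital $*$-algebra generated by $S_1,S_2,S_3,S_4$ subject to the relations $$S_rS_r^*S_r=S_r,\quad S_rS_r^*+S_r^*S_r=1\ (r=1,\dots,4),\quad \sum_{r=1}^4S_r^*S_r=2,\quad\sum_{r=1}^4S_r=0,\quad S_s^*S_r=-S_s^*S_sS_r^*S_r\ \ \forall r\neq s,$$ and $$\mathcal{O}_2=\mathcal{O}_3=\mathcal{O}_1/\langle S_1+S_2=S_3+S_4=0\rangle,$$ which is the universal unital $*$-algebra generated by $S_1,S_3$ subject to $S_rS_r^*S_r=S_r$, $S_rS_r^*+S_r^*S_r=1$ ($r=1,3$) and $S_1^*S_1+S_3^*S_3=1$. These arise as the universal coefficients of the quantum isomorphism $P:M_2\to\mathbb{C}^4\otimes\mathcal{O}_d$ in the following way, where $\tilde e_{ij}=\sqrt2e_{ij}$ and $\tilde e_r=2e_r$: $$P\tilde e_{11}=\sum_{r=1}^4\tilde e_r\otimes\frac{S_rS_r^*}{\sqrt2},\quad P\tilde e_{12}=\sum_{r=1}^4\tilde e_r\otimes\frac{S_r}{\sqrt2},\quad P\tilde e_{21}=\sum_{r=1}^4\tilde e_r\otimes\frac{S_r^*}{\sqrt2},\quad P\tilde e_{22}=\sum_{r=1}^4\tilde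 e_r\otimes\frac{S_r^*S_r}{\sqrt2}.$$
   Context: $\tau=\mathrm{Tr}/2$ on $M_2=M_2(\mathbb{C})$; $\tau_{\mathbb{C}^4}=\mathrm{Tr}/4$ on the diagonal $4\times4$ matrices $\mathbb{C}^4$. $e_{ij}$ are the matrix units of $M_2$, and $e_r$ the minimal projections of $\mathbb{C}^4$; $\{\tilde e_{ij}=\sqrt2e_{ij}\}$ and $\{\tilde e_r=2e_r\}$ are orthonormal bases of $L^2(M_2,\tau)$ and $L^2(\mathbb{C}^4,\tau_{\mathbb{C}^4})$ (inner product $\langle x|y\rangle_\psi=\psi(x^*y)$). With respect to $(\tilde e_{11},\tilde e_{12},\tilde e_{21},\tilde e_{22})$, $$A_1=\mathrm{id},\ A_2=\begin{pmatrix}2&0&0&0\\0&0&0&0\\0&0&0&0\\0&0&0&2\end{pmatrix},\ A_3=\begin{pmatrix}1&0&0&2\\0&1&0&0\\0&0&1&0\\2&0&0&1\end{pmatrix},\ A_4=\begin{pmatrix}2&0&0&2\\0&0&0&0\\0&0&0&0\\2&0&0&2\end{pmatrix},$$ and in the standard basis of $\mathbb{C}^4$, $$A'_1=I_4,\ A'_2=\begin{pmatrix}1&1&0&0\\1&1&0&0\\0&0&1&1\\0&0&1&1\end{pmatrix},\ A'_3=\begin{pmatrix}1&0&1&1\\0&1&1&1\\1&1&1&0\\1&1&0&1\end{pmatrix},\ A'_4=\text{the all-ones matrix}.$$ Bigalois extension: for quantum graphs $\mathcal{G}=(B,\psi,A)$, $\mathcal{G}'=(B',\psi',A')$ with orthonormal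 bases $\{e_i\}$, $\{e'_k\}$ of $L^2(B,\psi)$, $L^2(B',\psi')$, $\mathcal{O}(G^+(\mathcal{G}',\mathcal{G}))$ is the universal unital $*$-algebra generated by elements $P_i^k$ such that $P:B\to B'\otimes\mathcal{O}(G^+(\mathcal{G}',\mathcal{G}))$, $P(e_i)=\sum_ke'_k\otimes P_i^k$, is a unital $*$-homomorphism, the matrix $(P_i^k)_{k,i}$ is unitary, and $PA=(A'\otimes\mathrm{id})P$. Such a $P$ is called a quantum isomorphism. *)

theory Defs
  imports
    "HOL-Analysis.Analysis"
    "HOL-Algebra.QuotRing"
    "HOL-Library.Poly_Mapping"
begin

section \<open>Unital complex star-algebras\<close>

record 'a star_algebra = "'a ring" +
  scale :: "complex \<Rightarrow> 'a \<Rightarrow> 'a"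
  star :: "'a \<Rightarrow> 'a"

locale unital_star_algebra = ring A for A :: "('a, 'b) star_algebra_scheme" (structure) +
  assumes scale_closed: "x \<in> carrier A \<Longrightarrow> scale A c x \<in> carrier A"
    and scale_one: "x \<in> carrier A \<Longrightarrow> scale A 1 x = x"
    and scale_scale: "x \<in> carrier A \<Longrightarrow> scale A c (scale A d x) = scale A (c * d) x"
    and scale_add_left: "x \<in> carrier A \<Longrightarrow> scale A (c + d) x = scale A c x \<oplus> scale A d x"
    and scale_add_right:
      "\<lbrakk>x \<in> carrier A; y \<in> carrier A\<rbrakk> \<Longrightarrow> scale A c (x \<oplus> y) = scale A c x \<oplus> scale A c y"
    and scale_mult_left:
      "\<lbrakk>x \<in> carrier A; y \<in> carrier A\<rbrakk> \<Longrightarrow> scale A c x \<otimes> y = scale A c (x \<otimes> y)"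
    and scale_mult_right:
      "\<lbrakk>x \<in> carrier A; y \<in> carrier A\<rbrakk> \<Longrightarrow> x \<otimes> scale A c y = scale A c (x \<otimes> y)"
    and star_closed: "x \<in> carrier A \<Longrightarrow> star A x \<in> carrier A"
    and star_star: "x \<in> carrier A \<Longrightarrow> star A (star A x) = x"
    and star_add: "\<lbrakk>x \<in> carrier A; y \<in> carrier A\<rbrakk> \<Longrightarrow> star A (x \<oplus> y) = star A x \<oplus> star A y"
    and star_mult: "\<lbrakk>x \<in> carrier A; y \<in> carrier A\<rbrakk> \<Longrightarrow> star A (x \<otimes> y) = star A y \<otimes> star A x"
    and star_scale: "x \<in> carrier A \<Longrightarrow> star A (scale A c x) = scale A (cnj c) (star A x)"

definition star_hom ::
  "('a, 'c) star_algebra_scheme \<Rightarrow> ('b, 'd) star_algebra_scheme \<Rightarrow> ('a \<Rightarrow> 'b) set"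
  where "star_hom A B =
    {\<phi> \<in> ring_hom A B. \<forall>x\<in>carrier A.
       (\<forall>c. \<phi> (scale A c x) = scale B c (\<phi> x)) \<and> \<phi> (star A x) = star B (\<phi> x)}"

definition star_iso ::
  "('a, 'c) star_algebra_scheme \<Rightarrow> ('b, 'd) star_algebra_scheme \<Rightarrow> ('a \<Rightarrow> 'b) set"
  where "star_iso A B = {\<phi> \<in> star_hom A B. bij_betw \<phi> (carrier A) (carrier B)}"

text \<open>The two-sided star-ideal generated by \<open>X\<close>. It is automatically a complex subspace,
  because \<open>scale A c x = scale A c \<one> \<otimes> x\<close>.\<close>

definition star_ideal :: "('a, 'b) star_algebra_scheme \<Rightarrow> 'a set \<Rightarrow> 'a set"
  where "star_ideal A X = \<Inter>{J. ideal J A \<and> star A ` J \<subseteq> J \<and> X \<subseteq> J}"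

text \<open>As in \<^const>\<open>FactRing\<close>, the elements of the quotient are the cosets of \<open>J\<close>.\<close>

definition star_quotient ::
  "('a, 'b) star_algebra_scheme \<Rightarrow> 'a set \<Rightarrow> 'a set star_algebra"
  where "star_quotient A J =
    ring.extend (A Quot J)
      (star_algebra.fields (\<lambda>c X. \<Union>x\<in>X. J +>\<^bsub>A\<^esub> scale A c x) (\<lambda>X. star A ` X))"


section \<open>Free star-algebras, generators and relations\<close>

text \<open>The free unital star-algebra on \<open>'g\<close> is the complex monoid algebra of the free monoid on
  the letters \<open>g\<close>, \<open>g\<^sup>*\<close>. \<^typ>\<open>('m, complex) poly_mapping\<close> carries the convolution product of the
  additively written monoid \<open>'m\<close>, so concatenation of words has to be called \<open>+\<close>.\<close>

datatype 'g letter = Gen 'g | GenStar 'g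

datatype 'g star_word = Word (letters: "'g letter list")

instantiation star_word :: (type) monoid_add
begin

definition zero_star_word :: "'a star_word"
  where "0 = Word []"

definition plus_star_word :: "'a star_word \<Rightarrow> 'a star_word \<Rightarrow> 'a star_word"
  where "v + w = Word (letters v @ letters w)"

instance
  by standard (simp_all add: zero_star_word_def plus_star_word_def)

end

type_synonym 'g free = "'g star_word \<Rightarrow>\<^sub>0 complex"

fun letter_star :: "'g letter \<Rightarrow> 'g letter"
  where
    "letter_star (Gen g) = GenStar g"
  | "letter_star (GenStar g) = Gen g"

definition word_star :: "'g star_word \<Rightarrow> 'g star_word"
  where "word_star w = Word (rev (map letter_star (letters w)))"

definition fscale :: "complex \<Rightarrow> 'g free \<Rightarrow> 'g free"
  where "fscale c x = Poly_Mapping.single 0 c * x"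

definition fstar :: "'g free \<Rightarrow> 'g free"
  where "fstar x =
    (\<Sum>w\<in>Poly_Mapping.keys x.
       Poly_Mapping.single (word_star w) (cnj (Poly_Mapping.lookup x w)))"

definition gen :: "'g \<Rightarrow> 'g free"
  where "gen g = Poly_Mapping.single (Word [Gen g]) 1"

definition free_star_algebra :: "'g free star_algebra"
  where "free_star_algebra =
    \<lparr>carrier = UNIV, mult = (*), one = 1, zero = 0, add = (+), scale = fscale, star = fstar\<rparr>"

text \<open>The universal unital star-algebra generated by the elements of \<open>'g\<close> subject to the
  relations \<open>\<rho> = 0\<close> for \<open>\<rho> \<in> R\<close>.\<close>

definition presented :: "'g free set \<Rightarrow> 'g free set star_algebra"
  where "presented R = star_quotient free_star_algebra (star_ideal free_star_algebra R)"

definition presented_class :: "'g free set \<Rightarrow> 'g free \<Rightarrow> 'g free set"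
  where "presented_class R x =
    star_ideal free_star_algebra R +>\<^bsub>(free_star_algebra :: 'g free star_algebra)\<^esub> x"

lemma free_eq_sum:
  "x = (\<Sum>w\<in>Poly_Mapping.keys x. Poly_Mapping.single w (Poly_Mapping.lookup x w))"
proof (rule poly_mapping_eqI)
  fix v
  have "Poly_Mapping.lookup
      (\<Sum>w\<in>Poly_Mapping.keys x. Poly_Mapping.single w (Poly_Mapping.lookup x w)) v =
    (\<Sum>w\<in>Poly_Mapping.keys x. if w = v then Poly_Mapping.lookup x w else 0)"
    unfolding lookup_sum lookup_single by (intro sum.cong) (auto simp: when_def)
  then show "Poly_Mapping.lookup x v = Poly_Mapping.lookup
      (\<Sum>w\<in>Poly_Mapping.keys x. Poly_Mapping.single w (Poly_Mapping.lookup x w)) v"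
    by (simp add: sum.delta in_keys_iff)
qed

lemma lookup_fscale: "Poly_Mapping.lookup (fscale c x) w = c * Poly_Mapping.lookup x w"
proof -
  have "fscale c x =
      (\<Sum>v\<in>Poly_Mapping.keys x. Poly_Mapping.single v (c * Poly_Mapping.lookup x v))"
    by (subst free_eq_sum[of x]) (simp add: fscale_def sum_distrib_left mult_single)
  then have "Poly_Mapping.lookup (fscale c x) w =
      (\<Sum>v\<in>Poly_Mapping.keys x. if v = w then c * Poly_Mapping.lookup x v else 0)"
    unfolding lookup_sum lookup_single by (auto simp: when_def lookup_sum lookup_single intro!: sum.cong)
  then show ?thesis
    by (simp add: sum.delta in_keys_iff)
qed

lemma single_zero_commute: "x * Poly_Mapping.single 0 c = Poly_Mapping.single 0 c * x"
  for x :: "'g free"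
proof -
  let ?s = "\<Sum>w\<in>Poly_Mapping.keys x. Poly_Mapping.single w (Poly_Mapping.lookup x w)"
  have "?s * Poly_Mapping.single 0 c = Poly_Mapping.single 0 c * ?s"
    by (simp add: sum_distrib_left sum_distrib_right mult_single mult.commute)
  then show ?thesis
    by (simp flip: free_eq_sum)
qed

lemma fscale_mult_right: "x * fscale c y = fscale c (x * y)"
  by (simp add: fscale_def single_zero_commute flip: mult.assoc)

lemma fscale_simps:
  "fscale (c + d) x = fscale c x + fscale d x"
  "fscale c (x + y) = fscale c x + fscale c y"
  "fscale 1 x = x"
  "fscale c (fscale d x) = fscale (c * d) x"
  "fscale c x * y = fscale c (x * y)"
  by (simp_all add: fscale_def single_add distrib_right distrib_left mult_single flip: mult.assoc)

lemma word_star_word_star [simp]: "word_star (word_star w) = w"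
proof -
  have "letter_star (letter_star l) = l" for l :: "'a letter"
    by (cases l) auto
  then show ?thesis
    by (simp add: word_star_def rev_map comp_def)
qed

lemma word_star_plus: "word_star (v + w) = word_star w + word_star v"
  by (simp add: word_star_def plus_star_word_def)

lemma lookup_fstar: "Poly_Mapping.lookup (fstar x) w = cnj (Poly_Mapping.lookup x (word_star w))"
proof -
  have "Poly_Mapping.lookup (fstar x) w =
    (\<Sum>v\<in>Poly_Mapping.keys x. if v = word_star w then cnj (Poly_Mapping.lookup x v) else 0)"
    unfolding fstar_def lookup_sum lookup_single by (intro sum.cong) (auto simp: when_def)
  also have "\<dots> = cnj (Poly_Mapping.lookup x (word_star w))"
    by (simp add: sum.delta in_keys_iff)
  finally show ?thesis .
qed

lemma fstar_add: "fstar (x + y) = fstar x + fstar y"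
  by (rule poly_mapping_eqI) (simp add: lookup_fstar lookup_add)

lemma fstar_fstar: "fstar (fstar x) = x"
  by (rule poly_mapping_eqI) (simp add: lookup_fstar)

lemma fstar_fscale: "fstar (fscale c x) = fscale (cnj c) (fstar x)"
  by (rule poly_mapping_eqI) (simp add: lookup_fstar lookup_fscale)


lemma fstar_zero: "fstar 0 = 0"
  by (simp add: fstar_def)

lemma fstar_sum: "fstar (sum f I) = (\<Sum>i\<in>I. fstar (f i))"
  by (induction I rule: infinite_finite_induct) (simp_all add: fstar_zero fstar_add)

lemma fstar_single: "fstar (Poly_Mapping.single w c) = Poly_Mapping.single (word_star w) (cnj c)"
  by (cases "c = 0") (simp_all add: fstar_def)

lemma fstar_mult: "fstar (x * y) = fstar y * fstar x"
proof -
  let ?s = "\<lambda>x. \<Sum>w\<in>Poly_Mapping.keys x. Poly_Mapping.single w (Poly_Mapping.lookup x w)"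
  have "fstar (?s x * ?s y) = fstar (?s y) * fstar (?s x)"
    unfolding sum_product fstar_sum mult_single fstar_single
    by (subst sum.swap) (simp add: word_star_plus mult.commute)
  then show ?thesis
    by (simp flip: free_eq_sum)
qed

lemma unital_star_algebra_free: "unital_star_algebra (free_star_algebra :: 'a free star_algebra)"
proof -
  have "ring (free_star_algebra :: 'a free star_algebra)"
  proof (rule ringI)
    show "abelian_group (free_star_algebra :: 'a free star_algebra)"
      by (rule abelian_groupI)
        (auto simp: free_star_algebra_def add.assoc add.commute intro: exI[of _ "- x" for x] add.left_inverse)
    show "Group.monoid (free_star_algebra :: 'a free star_algebra)"
      by (rule monoidI) (auto simp: free_star_algebra_def mult.assoc)
  qed (auto simp: free_star_algebra_def distrib_left distrib_right)
  then show ?thesis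
    unfolding unital_star_algebra_def unital_star_algebra_axioms_def
    by (auto simp: free_star_algebra_def fstar_add fstar_mult fstar_fstar fstar_fscale
      fscale_mult_right fscale_simps)
qed

context unital_star_algebra
begin

lemma ideal_star_ideal:
  assumes "X \<subseteq> carrier A"
  shows "ideal (star_ideal A X) A"
  unfolding star_ideal_def
proof (rule i_Intersect)
  show "\<And>J. J \<in> {J. ideal J A \<and> star A ` J \<subseteq> J \<and> X \<subseteq> J} \<Longrightarrow> ideal J A"
    by simp
  have "star A ` carrier A \<subseteq> carrier A"
    using star_closed by blast
  then show "{J. ideal J A \<and> star A ` J \<subseteq> J \<and> X \<subseteq> J} \<noteq> {}"
    using oneideal assms by blast
qed

lemma star_ideal_star_closed: "star A ` star_ideal A X \<subseteq> star_ideal A X"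
  unfolding star_ideal_def by blast

lemma star_quotient_simps:
  "carrier (star_quotient A J) = a_rcosets J"
  "mult (star_quotient A J) = rcoset_mult A J"
  "one (star_quotient A J) = J +> \<one>"
  "zero (star_quotient A J) = J"
  "add (star_quotient A J) = set_add A"
  "scale (star_quotient A J) = (\<lambda>c X. \<Union>x\<in>X. J +> scale A c x)"
  "star (star_quotient A J) = (\<lambda>X. star A ` X)"
  by (simp_all add: star_quotient_def ring.extend_def star_algebra.fields_def FactRing_def)

lemma unital_star_algebra_quotient:
  assumes "ideal J A" and star: "star A ` J \<subseteq> J"
  shows "unital_star_algebra (star_quotient A J)"
proof -
  interpret J: ideal J A by fact
  let ?Q = "star_quotient A J"
  have scale_in: "scale A c x \<in> J" if "x \<in> J" for c x
  proof -
    have x: "x \<in> carrier A" using that by (rule J.Icarr)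
    have "scale A c x = scale A c \<one> \<otimes> x"
      using x by (simp add: scale_mult_left)
    then show ?thesis
      using that by (simp add: J.I_l_closed scale_closed)
  qed
  have star_in: "star A j \<in> J" if "j \<in> J" for j
    using that star by blast
  have in_coset: "y \<in> J +> x \<longleftrightarrow> (\<exists>j\<in>J. y = j \<oplus> x)" for x y
    by (auto simp: a_r_coset_def')
  have coset_eq: "J +> (j \<oplus> x) = J +> x" if "j \<in> J" "x \<in> carrier A" for j x
    by (rule J.a_repr_independence'[symmetric]) (use that in \<open>auto simp: in_coset\<close>)
  have sc: "scale ?Q c (J +> x) = J +> scale A c x" if "x \<in> carrier A" for c x
  proof -
    have *: "J +> scale A c y = J +> scale A c x" if "y \<in> J +> x" for y
      using that \<open>x \<in> carrier A\<close>
      by (auto simp: in_coset scale_add_right J.Icarr scale_in scale_closed coset_eq)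
    moreover have "J +> x \<noteq> {}"
      using that J.a_rcos_self by blast
    ultimately show ?thesis
      unfolding star_quotient_simps by (intro SUP_eq_const) auto
  qed
  have st: "star ?Q (J +> x) = J +> star A x" if x: "x \<in> carrier A" for x
  proof -
    have "star A y \<in> J +> star A x" if "y \<in> J +> x" for y
      using that x star_in by (fastforce simp: in_coset star_add J.Icarr)
    moreover have "y \<in> star A ` (J +> x)" if y: "y \<in> J +> star A x" for y
    proof -
      obtain j where j: "j \<in> J" "y = j \<oplus> star A x"
        using y by (auto simp: in_coset)
      then have "y = star A (star A j \<oplus> x)" "star A j \<oplus> x \<in> J +> x"
        using x star_in by (auto simp: in_coset star_add star_star star_closed J.Icarr)
      then show ?thesis by blast
    qed
    ultimately show ?thesis
      unfolding star_quotient_simps by blast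
  qed
  have "ring ?Q"
    using J.quotient_is_ring
    unfolding ring_def abelian_group_def abelian_monoid_def abelian_group_axioms_def ring_axioms_def
      comm_group_def comm_monoid_def comm_monoid_axioms_def Group.group_def group_axioms_def
      Group.monoid_def Units_def star_quotient_simps FactRing_def partial_object.select_convs
      monoid.select_convs ring.select_convs .
  moreover have rep: "\<exists>x\<in>carrier A. X = J +> x" if "X \<in> carrier ?Q" for X
    using that by (auto simp: star_quotient_simps A_RCOSETS_def' a_r_coset_def')
  have add: "(J +> x) \<oplus>\<^bsub>?Q\<^esub> (J +> y) = J +> (x \<oplus> y)"
    and mul: "(J +> x) \<otimes>\<^bsub>?Q\<^esub> (J +> y) = J +> (x \<otimes> y)"
    if "x \<in> carrier A" "y \<in> carrier A" for x y
    using that by (simp_all add: star_quotient_simps J.a_rcos_sum J.rcoset_mult_add)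
  have car: "J +> x \<in> carrier ?Q" if "x \<in> carrier A" for x
    using that by (simp add: star_quotient_simps a_rcosetsI J.a_subset)
  have "unital_star_algebra_axioms ?Q"
    by (rule unital_star_algebra_axioms.intro; (drule rep)?; (drule rep)?; (elim bexE)?;
      simp add: sc st add mul car scale_closed star_closed scale_one scale_scale scale_add_left
        scale_add_right scale_mult_left scale_mult_right star_star star_add star_mult star_scale)
  ultimately show ?thesis
    by (simp add: unital_star_algebra_def)
qed

end

lemma unital_star_algebra_presented: "unital_star_algebra (presented R)"
  unfolding presented_def
  by (intro unital_star_algebra.unital_star_algebra_quotient unital_star_algebra_free
     unital_star_algebra.ideal_star_ideal unital_star_algebra.star_ideal_star_closed)
   (simp add: free_star_algebra_def)

definition is_universal_star_algebra ::
  "('a, 'b) star_algebra_scheme \<Rightarrow> ('g \<Rightarrow> 'a) \<Rightarrow> 'g free set \<Rightarrow> bool"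
  where "is_universal_star_algebra A s R \<longleftrightarrow>
    (\<exists>\<phi>\<in>star_iso (presented R) A. \<forall>g. \<phi> (presented_class R (gen g)) = s g)"


section \<open>Quantum graphs and bigalois extensions\<close>

definition msmult :: "complex \<Rightarrow> complex^'n^'m \<Rightarrow> complex^'n^'m"
  where "msmult c x = (\<chi> p q. c * x $ p $ q)"

definition mstar :: "('a \<Rightarrow> 'b) \<Rightarrow> 'a^'n^'m \<Rightarrow> 'b^'m^'n"
  where "mstar s x = (\<chi> p q. s (x $ q $ p))"

definition entries :: "'a^'n^'m \<Rightarrow> 'a set"
  where "entries x = {x $ p $ q | p q. True}"

text \<open>A quantum graph \<open>(B, \<psi>, A)\<close>, the finite-dimensional C*-algebra \<open>B\<close> being realised as a
  unital star-subalgebra of a matrix algebra. Only the restrictions of \<open>qstate\<close> and \<open>qadj\<close>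
  to \<open>qalg\<close> matter.\<close>

record 'n quantum_graph =
  qalg :: "(complex^'n^'n) set"
  qstate :: "complex^'n^'n \<Rightarrow> complex"
  qadj :: "complex^'n^'n \<Rightarrow> complex^'n^'n"

definition qinner :: "('n::finite, 'z) quantum_graph_scheme \<Rightarrow> complex^'n^'n \<Rightarrow> complex^'n^'n \<Rightarrow> complex"
  where "qinner G x y = qstate G (mstar cnj x ** y)"

definition orthonormal_basis :: "('n::finite, 'z) quantum_graph_scheme \<Rightarrow> ('i::finite \<Rightarrow> complex^'n^'n) \<Rightarrow> bool"
  where "orthonormal_basis G e \<longleftrightarrow>
    range e \<subseteq> qalg G \<and> (\<forall>i j. qinner G (e i) (e j) = (if i = j then 1 else 0)) \<and>
    (\<forall>x\<in>qalg G. x = (\<Sum>i\<in>UNIV. msmult (qinner G (e i) x) (e i)))"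

text \<open>For a star-algebra \<open>O\<close> and \<open>B' \<subseteq> M\<^sub>n\<close>, the algebra \<open>B' \<otimes> O\<close> is identified with the
  subalgebra of \<open>M\<^sub>n(O)\<close> spanned by the matrices \<open>b \<otimes> x\<close> with entries \<open>b\<^sub>p\<^sub>q x\<close>; below, \<open>O\<close> is
  the free star-algebra on the symbols \<open>P\<^sub>i\<^sup>k\<close>, written \<open>gen (i, k)\<close>. The map \<open>amplified\<close> is
  \<open>(T \<otimes> id) P\<close> for the linear map \<open>P\<close> with \<open>P e\<^sub>i = (\<Sum>k. e'\<^sub>k \<otimes> P\<^sub>i\<^sup>k)\<close>.\<close>

definition free_tensor :: "complex^'n^'n \<Rightarrow> 'g free \<Rightarrow> ('g free)^'n^'n"
  where "free_tensor b x = (\<chi> p q. fscale (b $ p $ q) x)"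

definition amplified ::
  "(complex^'m^'m \<Rightarrow> complex^'m^'m) \<Rightarrow> ('k::finite \<Rightarrow> complex^'m^'m) \<Rightarrow>
   ('n::finite, 'z) quantum_graph_scheme \<Rightarrow> ('i::finite \<Rightarrow> complex^'n^'n) \<Rightarrow>
   complex^'n^'n \<Rightarrow> (('i \<times> 'k) free)^'m^'m"
  where "amplified T e' G e x =
    (\<Sum>i\<in>UNIV. \<Sum>k\<in>UNIV. free_tensor (T (e' k)) (fscale (qinner G (e i) x) (gen (i, k))))"

definition formal_map ::
  "('k::finite \<Rightarrow> complex^'m^'m) \<Rightarrow>
   ('n::finite, 'z) quantum_graph_scheme \<Rightarrow> ('i::finite \<Rightarrow> complex^'n^'n) \<Rightarrow>
   complex^'n^'n \<Rightarrow> (('i \<times> 'k) free)^'m^'m"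
  where "formal_map e' G e = amplified (\<lambda>b. b) e' G e"

definition coefficient_matrix :: "(('i \<times> 'k) free)^'i^'k"
  where "coefficient_matrix = (\<chi> k i. gen (i, k))"

text \<open>The relations saying that \<open>P\<close> is multiplicative, unital and star-preserving, that
  \<open>P A = (A' \<otimes> id) P\<close>, and that the matrix \<open>(P\<^sub>i\<^sup>k)\<^sub>k\<^sub>,\<^sub>i\<close> is unitary.\<close>

definition bigalois_relations ::
  "('m::finite, 'y) quantum_graph_scheme \<Rightarrow> ('k::finite \<Rightarrow> complex^'m^'m) \<Rightarrow>
   ('n::finite, 'z) quantum_graph_scheme \<Rightarrow> ('i::finite \<Rightarrow> complex^'n^'n) \<Rightarrow> ('i \<times> 'k) free set"
  where "bigalois_relations G' e' G e =
    (let P = formal_map e' G e;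
         U = coefficient_matrix :: (('i \<times> 'k) free)^'i^'k
     in (\<Union>x\<in>qalg G. \<Union>y\<in>qalg G. entries (P (x ** y) - P x ** P y))
        \<union> entries (P (mat 1) - mat 1)
        \<union> (\<Union>x\<in>qalg G. entries (P (mstar cnj x) - mstar fstar (P x)))
        \<union> (\<Union>x\<in>qalg G. entries (P (qadj G x) - amplified (qadj G') e' G e x))
        \<union> entries (mstar fstar U ** U - mat 1)
        \<union> entries (U ** mstar fstar U - mat 1))"

definition bigalois ::
  "('m::finite, 'y) quantum_graph_scheme \<Rightarrow> ('k::finite \<Rightarrow> complex^'m^'m) \<Rightarrow>
   ('n::finite, 'z) quantum_graph_scheme \<Rightarrow> ('i::finite \<Rightarrow> complex^'n^'n) \<Rightarrow>
   ('i \<times> 'k) free set star_algebra"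
  where "bigalois G' e' G e = presented (bigalois_relations G' e' G e)"

text \<open>The universal quantum isomorphism \<open>P : B \<rightarrow> B' \<otimes> O(G\<^sup>+(G', G))\<close>, with values in matrices
  over the bigalois extension.\<close>

definition quantum_iso ::
  "('m::finite, 'y) quantum_graph_scheme \<Rightarrow> ('k::finite \<Rightarrow> complex^'m^'m) \<Rightarrow>
   ('n::finite, 'z) quantum_graph_scheme \<Rightarrow> ('i::finite \<Rightarrow> complex^'n^'n) \<Rightarrow>
   complex^'n^'n \<Rightarrow> (('i \<times> 'k) free set)^'m^'m"
  where "quantum_iso G' e' G e x =
    (\<chi> p q. presented_class (bigalois_relations G' e' G e) (formal_map e' G e x $ p $ q))"

definition tensor_sum ::
  "('a, 'b) star_algebra_scheme \<Rightarrow> ('k::finite \<Rightarrow> complex^'m^'m) \<Rightarrow> ('k \<Rightarrow> 'a) \<Rightarrow> 'a^'m^'m"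
  \<comment> \<open>\<open>\<Sum>k. b k \<otimes> x k\<close> as a matrix over \<open>A\<close>\<close>
  where "tensor_sum A b x = (\<chi> p q. \<Oplus>\<^bsub>A\<^esub>k\<in>UNIV. scale A (b k $ p $ q) (x k))"


section \<open>The quantum graphs on \<open>M\<^sub>2\<close> and \<open>\<complex>\<^sup>4\<close>\<close>

text \<open>In the finite index type \<open>4\<close> the indices are \<open>1, 2, 3, 4\<close>, with \<open>4 = 0\<close>; similarly \<open>2 = 0\<close>
  in the type \<open>2\<close>.\<close>

definition matrix_unit :: "'n \<Rightarrow> 'n \<Rightarrow> complex^'n^'n"
  where "matrix_unit i j = (\<chi> p q. if p = i \<and> q = j then 1 else 0)"

definition M2_basis :: "4 \<Rightarrow> complex^2^2"
  \<comment> \<open>the matrix units multiplied by \<open>\<surd>2\<close>, in the order 11, 12, 21, 22\<close>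
  where "M2_basis i = msmult (complex_of_real (sqrt 2))
    ((vector [matrix_unit 1 1, matrix_unit 1 2, matrix_unit 2 1, matrix_unit 2 2]
        :: (complex^2^2)^4) $ i)"

definition C4_basis :: "4 \<Rightarrow> complex^4^4"
  where "C4_basis r = msmult 2 (matrix_unit r r)"

definition M2_adj :: "nat \<Rightarrow> complex^4^4"
  where "M2_adj d =
    (if d = 1 then mat 1
     else if d = 2 then vector
       [vector [2, 0, 0, 0],
        vector [0, 0, 0, 0],
        vector [0, 0, 0, 0],
        vector [0, 0, 0, 2]]
     else if d = 3 then vector
       [vector [1, 0, 0, 2],
        vector [0, 1, 0, 0],
        vector [0, 0, 1, 0],
        vector [2, 0, 0, 1]]
     else vector
       [vector [2, 0, 0, 2],
        vector [0, 0, 0, 0],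
        vector [0, 0, 0, 0],
        vector [2, 0, 0, 2]])"

definition C4_adj :: "nat \<Rightarrow> complex^4^4"
  where "C4_adj d =
    (if d = 1 then mat 1
     else if d = 2 then vector
       [vector [1, 1, 0, 0],
        vector [1, 1, 0, 0],
        vector [0, 0, 1, 1],
        vector [0, 0, 1, 1]]
     else if d = 3 then vector
       [vector [1, 0, 1, 1],
        vector [0, 1, 1, 1],
        vector [1, 1, 1, 0],
        vector [1, 1, 0, 1]]
     else vector
       [vector [1, 1, 1, 1],
        vector [1, 1, 1, 1],
        vector [1, 1, 1, 1],
        vector [1, 1, 1, 1]])"

definition M2_state :: "complex^2^2 \<Rightarrow> complex"
  where "M2_state x = trace x / 2"

definition C4_state :: "complex^4^4 \<Rightarrow> complex"
  where "C4_state x = trace x / 4"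

definition M2_graph :: "nat \<Rightarrow> 2 quantum_graph"
  where "M2_graph d =
    \<lparr>qalg = UNIV, qstate = M2_state,
     qadj = (\<lambda>x. \<Sum>i\<in>UNIV. \<Sum>j\<in>UNIV.
       msmult (M2_adj d $ i $ j * M2_state (mstar cnj (M2_basis j) ** x)) (M2_basis i))\<rparr>"

definition C4_graph :: "nat \<Rightarrow> 4 quantum_graph"
  where "C4_graph d =
    \<lparr>qalg = {x. \<forall>p q. p \<noteq> q \<longrightarrow> x $ p $ q = 0}, qstate = C4_state,
     qadj = (\<lambda>x. \<Sum>r\<in>UNIV. \<Sum>s\<in>UNIV. msmult (C4_adj d $ r $ s * x $ s $ s) (matrix_unit r r))\<rparr>"

lemma orthonormal_basis_C4: "orthonormal_basis (C4_graph d) C4_basis"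
proof -
  have inner: "qinner (C4_graph d) (C4_basis r) x = x $ r $ r / 2" for r :: 4 and x
  proof -
    have "(mstar cnj (C4_basis r) ** x) $ p $ p = (if p = r then 2 * x $ r $ r else 0)" for p
      by (simp add: C4_basis_def mstar_def msmult_def matrix_unit_def matrix_matrix_mult_def
          if_distrib if_distribR sum.delta cong: if_cong conj_cong)
    then show ?thesis
      by (simp add: qinner_def C4_graph_def C4_state_def trace_def)
  qed
  have "x = (\<Sum>r\<in>UNIV. msmult (x $ r $ r / 2) (C4_basis r))" if "\<forall>p q. p \<noteq> q \<longrightarrow> x $ p $ q = 0" for x :: "complex^4^4"
    unfolding vec_eq_iff
  proof (intro allI)
    fix p q
    have "(\<Sum>r\<in>UNIV. msmult (x $ r $ r / 2) (C4_basis r)) $ p $ q =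
        (\<Sum>r\<in>UNIV. if r = p then (if p = q then x $ p $ p else 0) else 0)"
      unfolding sum_component
      by (intro sum.cong) (auto simp: msmult_def C4_basis_def matrix_unit_def)
    then show "x $ p $ q = (\<Sum>r\<in>UNIV. msmult (x $ r $ r / 2) (C4_basis r)) $ p $ q"
      using that by (simp add: sum.delta')
  qed
  then show ?thesis
    unfolding orthonormal_basis_def inner
    by (auto simp: C4_graph_def C4_basis_def msmult_def matrix_unit_def)
qed

lemma orthonormal_basis_M2: "orthonormal_basis (M2_graph d) M2_basis"
proof -
  have s: "complex_of_real (sqrt 2) * complex_of_real (sqrt 2) = 2"
    by (simp flip: of_real_mult)
  have v4: "(vector [a, b, c, e] :: (complex^2^2)^4) $ 1 = a"
    "(vector [a, b, c, e] :: (complex^2^2)^4) $ 2 = b"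
    "(vector [a, b, c, e] :: (complex^2^2)^4) $ 3 = c"
    "(vector [a, b, c, e] :: (complex^2^2)^4) $ 4 = e" for a b c e
    by (simp_all add: vector_def)
  show ?thesis
    unfolding orthonormal_basis_def
    apply (simp add: forall_4 sum_4 M2_graph_def qinner_def M2_state_def trace_def sum_2 M2_basis_def
       v4 mstar_def msmult_def matrix_unit_def matrix_matrix_mult_def vec_eq_iff forall_2)
    apply (simp add: s field_simps)
    done
qed


definition bigO :: "nat \<Rightarrow> (4 \<times> 4) free set star_algebra"
  where "bigO d = bigalois (C4_graph d) C4_basis (M2_graph d) M2_basis"

definition bigP :: "nat \<Rightarrow> complex^2^2 \<Rightarrow> ((4 \<times> 4) free set)^4^4"
  where "bigP d = quantum_iso (C4_graph d) C4_basis (M2_graph d) M2_basis"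


section \<open>The relations among the \<open>S\<^sub>r\<close>\<close>

definition partial_isometry_relations :: "'g \<Rightarrow> 'g free set"
  where "partial_isometry_relations r =
    {gen r * fstar (gen r) * gen r - gen r,
     gen r * fstar (gen r) + fstar (gen r) * gen r - 1}"

definition relations_14 :: "4 free set"
  where "relations_14 =
    (\<Union>r. partial_isometry_relations r)
    \<union> {(\<Sum>r\<in>UNIV. fstar (gen r) * gen r) - 2, (\<Sum>r\<in>UNIV. gen r)}
    \<union> {fstar (gen s) * gen r + fstar (gen s) * gen s * fstar (gen r) * gen r | r s. r \<noteq> s}"

text \<open>The generators \<open>1\<close> and \<open>2\<close> stand for \<open>S\<^sub>1\<close> and \<open>S\<^sub>3\<close>.\<close>

definition relations_23 :: "2 free set"
  where "relations_23 =
    (\<Union>r. partial_isometry_relations r)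
    \<union> {fstar (gen 1) * gen 1 + fstar (gen 2) * gen 2 - 1}"

definition coefficients_of_P :: "nat \<Rightarrow> (4 \<Rightarrow> (4 \<times> 4) free set) \<Rightarrow> bool"
  where "coefficients_of_P d S \<longleftrightarrow>
    (let A = bigO d; h = (\<lambda>x. scale A (1 / complex_of_real (sqrt 2)) x)
     in bigP d (M2_basis 1) = tensor_sum A C4_basis (\<lambda>r. h (S r \<otimes>\<^bsub>A\<^esub> star A (S r)))
      \<and> bigP d (M2_basis 2) = tensor_sum A C4_basis (\<lambda>r. h (S r))
      \<and> bigP d (M2_basis 3) = tensor_sum A C4_basis (\<lambda>r. h (star A (S r)))
      \<and> bigP d (M2_basis 4) = tensor_sum A C4_basis (\<lambda>r. h (star A (S r) \<otimes>\<^bsub>A\<^esub> S r)))"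

end

theory Submission
  imports Defs
begin

text \<open>
  Write \<open>P\<close> in coordinates: its \<open>k\<close>-th component is a linear map from \<open>M\<^sub>2\<close> to \<open>\<O>\<close>, determined
  by its values \<open>E k a b\<close> on the matrix units. That \<open>P\<close> is a unital star-homomorphism means that each
  \<open>E k\<close> is a system of matrix units in \<open>\<O>\<close>, and such a system is the same thing as the single
  element \<open>S k = E k 1 2\<close> with \<open>S S\<^sup>* S = S\<close> and \<open>S S\<^sup>* + S\<^sup>* S = 1\<close>; these two relations already force
  \<open>S\<^sup>2 = 0\<close>. Given the matrix units, orthonormality of the columns of \<open>(P\<^sub>i\<^sup>k)\<close> says that the sum of the
  \<open>E k b e\<close> over \<open>k\<close> is \<open>2\<close> or \<open>0\<close>, which amounts to the two sum relations, and orthonormality of its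
  rows is the relation between \<open>S\<^sub>s\<^sup>* S\<^sub>r\<close> and the supports, seen through the corner \<open>S\<^sub>s\<^sup>* S\<^sub>s\<close>.
  So the unitary homomorphism \<open>P\<close> is encoded by the relations of \<open>\<O>\<^sub>1\<close>.

  The intertwining relation adds little. For \<open>d = 1\<close> it is empty. For \<open>d = 4\<close> both adjacency matrices
  are multiples of the projection onto the unit, and the relation follows from the sum relations.
  For \<open>d = 2\<close> it says exactly that \<open>S\<^sub>1 + S\<^sub>2 = S\<^sub>3 + S\<^sub>4 = 0\<close>. Finally, both on \<open>M\<^sub>2\<close> and on \<open>\<complex>\<^sup>4\<close> the
  third adjacency matrix is the fourth minus the second plus the first, so that the relations for
  \<open>d = 3\<close> and \<open>d = 2\<close> agree modulo the others.

  All this is proved once, as a criterion for a star-ideal \<open>J\<close> of the free star-algebra on the \<open>P\<^sub>i\<^sup>k\<close>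
  to contain the relations for \<open>d\<close> (\<open>bigO_relations_iff\<close>). Since \<open>J\<close> is arbitrary, the criterion yields
  the equalities of the defining ideals. Applied to preimages of ideals under substitutions, it shows
  that expressing the \<open>P\<^sub>i\<^sup>k\<close> through the \<open>S\<^sub>r\<close> respects the relations, so that both
  presentations by partial isometries are isomorphic to the bigalois extensions
  (\<open>bigO_presentation\<close>). For \<open>d = 2\<close> the four partial isometries are \<open>S\<^sub>1, -S\<^sub>1, S\<^sub>3, -S\<^sub>3\<close>, and there
  \<open>S\<^sub>1\<^sup>* S\<^sub>1 + S\<^sub>3\<^sup>* S\<^sub>3 = 1\<close> implies all the mixed relations (\<open>balanced_signed_pair\<close>).
\<close>


section \<open>Star-ideals of the free star-algebra and congruences\<close>

text \<open>All computations in a presented algebra are carried out in the free star-algebra, modulo a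
  star-ideal. The free star-algebra is an instance of the class of rings, so its elements can be
  handled without carrier conditions. Stability under scalars is a consequence of stability under
  multiplication.\<close>

locale free_star_ideal =
  fixes J :: "'g free set"
  assumes zero_mem: "0 \<in> J"
    and add_mem: "x \<in> J \<Longrightarrow> y \<in> J \<Longrightarrow> x + y \<in> J"
    and mult_left_mem: "x \<in> J \<Longrightarrow> a * x \<in> J"
    and mult_right_mem: "x \<in> J \<Longrightarrow> x * a \<in> J"
    and star_mem: "x \<in> J \<Longrightarrow> fstar x \<in> J"

definition cong_mod :: "'g free set \<Rightarrow> 'g free \<Rightarrow> 'g free \<Rightarrow> bool"
  where "cong_mod J x y \<longleftrightarrow> x - y \<in> J"

context free_star_ideal
begin

abbreviation congr (infix "\<doteq>" 50)
  where "x \<doteq> y \<equiv> cong_mod J x y"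

lemma minus_mem: "x \<in> J \<Longrightarrow> - x \<in> J"
  using mult_left_mem[of x "- 1"] by simp

lemma scale_mem: "x \<in> J \<Longrightarrow> fscale c x \<in> J"
  unfolding fscale_def by (rule mult_left_mem)

lemma mem_iff_cong_zero: "x \<in> J \<longleftrightarrow> x \<doteq> 0"
  by (simp add: cong_mod_def)

lemma cong_refl [simp, intro]: "x \<doteq> x"
  by (simp add: cong_mod_def zero_mem)

lemma cong_sym: "x \<doteq> y \<Longrightarrow> y \<doteq> x"
  unfolding cong_mod_def using minus_mem by fastforce

lemma cong_trans [trans]: "x \<doteq> y \<Longrightarrow> y \<doteq> z \<Longrightarrow> x \<doteq> z"
  unfolding cong_mod_def using add_mem[of "x - y" "y - z"] by simp

lemma cong_add: "x \<doteq> x' \<Longrightarrow> y \<doteq> y' \<Longrightarrow> x + y \<doteq> x' + y'"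
  unfolding cong_mod_def using add_mem[of "x - x'" "y - y'"] by (simp add: algebra_simps)

lemma cong_minus: "x \<doteq> x' \<Longrightarrow> - x \<doteq> - x'"
  unfolding cong_mod_def using minus_mem[of "x - x'"] by simp

lemma cong_diff: "x \<doteq> x' \<Longrightarrow> y \<doteq> y' \<Longrightarrow> x - y \<doteq> x' - y'"
  using cong_add[of x x' "- y" "- y'"] cong_minus[of y y'] by simp

lemma cong_mult: "x \<doteq> x' \<Longrightarrow> y \<doteq> y' \<Longrightarrow> x * y \<doteq> x' * y'"
  unfolding cong_mod_def
  using add_mem[OF mult_right_mem[of "x - x'" y] mult_left_mem[of "y - y'" x']]
  by (simp add: algebra_simps)

lemma cong_star: "x \<doteq> x' \<Longrightarrow> fstar x \<doteq> fstar x'"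
  unfolding cong_mod_def using star_mem[of "x - x'"] fstar_add[of "x - x'" x'] 
  by simp

lemma cong_scale: "x \<doteq> x' \<Longrightarrow> fscale c x \<doteq> fscale c x'"
  unfolding fscale_def by (intro cong_mult cong_refl)

lemma cong_sum: "(\<And>i. i \<in> I \<Longrightarrow> f i \<doteq> g i) \<Longrightarrow> sum f I \<doteq> sum g I"
  by (induction I rule: infinite_finite_induct) (auto intro: cong_add)

lemma cong_cong:
  assumes "x \<doteq> x'" "y \<doteq> y'"
  shows "x \<doteq> y \<longleftrightarrow> x' \<doteq> y'"
  using assms cong_sym cong_trans by metis

end

lemma a_minus_free: "x \<ominus>\<^bsub>(free_star_algebra :: 'g free star_algebra)\<^esub> y = x - y"
proof -
  interpret F: unital_star_algebra "free_star_algebra :: 'g free star_algebra"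
    by (rule unital_star_algebra_free)
  have "\<ominus>\<^bsub>(free_star_algebra :: 'g free star_algebra)\<^esub> y = - y"
    by (rule F.minus_equality) (simp_all add: free_star_algebra_def)
  then show ?thesis
    by (simp add: a_minus_def) (simp add: free_star_algebra_def)
qed

lemma free_star_algebra_simps:
  "carrier free_star_algebra = UNIV" "mult free_star_algebra = (*)" "one free_star_algebra = 1"
  "zero free_star_algebra = 0" "add free_star_algebra = (+)" "scale free_star_algebra = fscale"
  "star free_star_algebra = fstar"
  by (simp_all add: free_star_algebra_def)

lemma free_star_ideal_iff:
  "free_star_ideal J \<longleftrightarrow> ideal J free_star_algebra \<and> star free_star_algebra ` J \<subseteq> J"
proof
  assume "free_star_ideal J"
  then interpret free_star_ideal J .
  interpret F: unital_star_algebra "free_star_algebra :: 'a free star_algebra"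
    by (rule unital_star_algebra_free)
  have "ideal J free_star_algebra"
  proof (rule idealI)
    show "subgroup J (add_monoid free_star_algebra)"
    proof (rule F.add.subgroupI)
      show "\<And>a. a \<in> J \<Longrightarrow> \<ominus>\<^bsub>free_star_algebra\<^esub> a \<in> J"
        using a_minus_free[of 0] F.minus_eq minus_mem
        by (metis F.add.inv_closed F.l_zero UNIV_I diff_0 free_star_algebra_simps(1,4))
    qed (use zero_mem in \<open>auto simp: free_star_algebra_simps add_mem\<close>)
  qed (auto simp: free_star_algebra_simps mult_left_mem mult_right_mem F.ring_axioms)
  then show "ideal J free_star_algebra \<and> star free_star_algebra ` J \<subseteq> J"
    by (auto simp: free_star_algebra_simps star_mem)
next
  assume *: "ideal J free_star_algebra \<and> star free_star_algebra ` J \<subseteq> J"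
  then interpret ideal J free_star_algebra by blast
  show "free_star_ideal J"
    using * additive_subgroup.zero_closed[OF additive_subgroup_axioms]
      additive_subgroup.a_closed[OF additive_subgroup_axioms] I_l_closed I_r_closed
    by unfold_locales (auto simp: free_star_algebra_simps)
qed

abbreviation free_ideal :: "'g free set \<Rightarrow> 'g free set"
  where "free_ideal R \<equiv> star_ideal free_star_algebra R"

lemma free_star_ideal_generated: "free_star_ideal (free_ideal R)"
proof -
  interpret F: unital_star_algebra "free_star_algebra :: 'a free star_algebra"
    by (rule unital_star_algebra_free)
  show ?thesis
    unfolding free_star_ideal_iff
    using F.ideal_star_ideal F.star_ideal_star_closed by (simp add: free_star_algebra_simps)
qed

lemma free_ideal_generators: "R \<subseteq> free_ideal R"
  unfolding star_ideal_def by blast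

lemma free_ideal_least: "free_star_ideal J \<Longrightarrow> R \<subseteq> J \<Longrightarrow> free_ideal R \<subseteq> J"
  unfolding star_ideal_def free_star_ideal_iff by blast

lemma free_ideal_subset_iff: "free_star_ideal J \<Longrightarrow> free_ideal R \<subseteq> J \<longleftrightarrow> R \<subseteq> J"
  using free_ideal_least[of J R] free_ideal_generators[of R] by blast

text \<open>Two sets of relations define literally the same algebra if the same star-ideals contain them.\<close>

lemma free_ideal_eqI:
  assumes "\<And>J. free_star_ideal J \<Longrightarrow> R \<subseteq> J \<longleftrightarrow> R' \<subseteq> J"
  shows "free_ideal R = free_ideal R'"
proof
  show "free_ideal R \<subseteq> free_ideal R'"
    using assms[of "free_ideal R'"] free_star_ideal_generated[of R'] free_ideal_generators[of R']
    by (simp add: free_ideal_subset_iff)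
  show "free_ideal R' \<subseteq> free_ideal R"
    using assms[of "free_ideal R"] free_star_ideal_generated[of R] free_ideal_generators[of R]
    by (simp add: free_ideal_subset_iff)
qed

lemma star_ideal_least: "ideal K A \<Longrightarrow> star A ` K \<subseteq> K \<Longrightarrow> X \<subseteq> K \<Longrightarrow> star_ideal A X \<subseteq> K"
  unfolding star_ideal_def by (rule Inter_lower) simp

lemma star_ideal_generators: "X \<subseteq> star_ideal A X"
  unfolding star_ideal_def by blast


section \<open>Quotients and isomorphisms\<close>

lemma star_hom_comp: "\<phi> \<in> star_hom A B \<Longrightarrow> \<psi> \<in> star_hom B C \<Longrightarrow> \<psi> \<circ> \<phi> \<in> star_hom A C"
  unfolding star_hom_def using ring_hom_trans[of \<phi> A B \<psi> C] by (simp add: ring_hom_closed[of \<phi> A B])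

lemma (in unital_star_algebra) quotient_projection:
  assumes "ideal J A" and star: "star A ` J \<subseteq> J"
  shows "(\<lambda>x. J +> x) \<in> star_hom A (star_quotient A J)"
    and "(\<lambda>x. J +> x) ` carrier A = carrier (star_quotient A J)"
proof -
  interpret J: ideal J A by fact
  let ?Q = "star_quotient A J"
  have eq: "J +> x = J +> y \<longleftrightarrow> x \<ominus> y \<in> J" if "x \<in> carrier A" "y \<in> carrier A" for x y
    using quotient_eq_iff_same_a_r_cos[OF \<open>ideal J A\<close> that] by blast
  have rep: "\<exists>j\<in>J. y = j \<oplus> x" if "y \<in> J +> x" for x y
    using that by (auto simp: a_r_coset_def')
  have absorb: "J +> (j \<oplus> x) = J +> x" if "j \<in> J" "x \<in> carrier A" for j x
    by (rule J.a_repr_independence'[symmetric]) (use that in \<open>auto simp: a_r_coset_def'\<close>)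
  have scale_mem: "scale A c j \<in> J" if "j \<in> J" for c j
  proof -
    have "scale A c j = scale A c \<one> \<otimes> j"
      using J.Icarr[OF that] by (simp add: scale_mult_left)
    then show ?thesis
      using that by (simp add: J.I_l_closed scale_closed)
  qed
  have sc: "scale ?Q c (J +> x) = J +> scale A c x" if x: "x \<in> carrier A" for c x
  proof -
    have "J +> scale A c y = J +> scale A c x" if "y \<in> J +> x" for y
      using rep[OF that] x by (auto simp: scale_add_right J.Icarr absorb scale_mem scale_closed)
    moreover have "J +> x \<noteq> {}"
      using J.a_rcos_self[OF x] by blast
    ultimately show ?thesis
      unfolding star_quotient_simps by (intro SUP_eq_const) auto
  qed
  have star_coset: "star A ` (J +> x) \<subseteq> J +> star A x" if x: "x \<in> carrier A" for x
    using star x by (auto dest!: rep simp: star_add J.Icarr) (auto simp: a_r_coset_def')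
  have st: "star ?Q (J +> x) = J +> star A x" if x: "x \<in> carrier A" for x
  proof -
    have "y \<in> star A ` (J +> x)" if y: "y \<in> J +> star A x" for y
    proof
      have "y \<in> carrier A"
        using rep[OF y] x by (auto simp: J.Icarr star_closed)
      then show "y = star A (star A y)"
        by (simp add: star_star)
      show "star A y \<in> J +> x"
        using star_coset[of "star A x"] y x by (auto simp: star_closed star_star)
    qed
    then show ?thesis
      using star_coset[OF x] unfolding star_quotient_simps by blast
  qed
  show "(\<lambda>x. J +> x) \<in> star_hom A ?Q"
    unfolding star_hom_def ring_hom_def
    by (auto simp: sc st)
       (auto simp: star_quotient_simps J.a_rcos_sum J.rcoset_mult_add a_rcosetsI J.a_subset)
  show "(\<lambda>x. J +> x) ` carrier A = carrier ?Q"
    by (auto simp: star_quotient_simps A_RCOSETS_def')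
qed

text \<open>All isomorphisms below arise in this way: the algebras on both sides are quotients of one
  algebra \<open>A\<close>, and \<open>\<psi>\<close> is well defined and injective because both projections identify the same pairs
  of elements.\<close>

lemma star_iso_of_same_kernel:
  assumes \<pi>: "\<pi> \<in> star_hom A B" "\<pi> ` carrier A = carrier B"
    and \<pi>': "\<pi>' \<in> star_hom A C" "\<pi>' ` carrier A = carrier C"
    and same: "\<And>x y. x \<in> carrier A \<Longrightarrow> y \<in> carrier A \<Longrightarrow> \<pi> x = \<pi> y \<longleftrightarrow> \<pi>' x = \<pi>' y"
    and A: "unital_star_algebra A"
  shows "\<exists>\<psi>\<in>star_iso B C. \<forall>x\<in>carrier A. \<psi> (\<pi> x) = \<pi>' x"
proof
  interpret A: unital_star_algebra A by fact
  define \<psi> where "\<psi> = \<pi>' \<circ> inv_into (carrier A) \<pi>"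
  have \<psi>: "\<psi> (\<pi> x) = \<pi>' x" if "x \<in> carrier A" for x
    using that same inv_into_into[of "\<pi> x" \<pi> "carrier A"] f_inv_into_f[of "\<pi> x" \<pi> "carrier A"]
    by (auto simp: \<psi>_def)
  then show "\<forall>x\<in>carrier A. \<psi> (\<pi> x) = \<pi>' x" by blast
  have ops: "\<pi> x \<otimes>\<^bsub>B\<^esub> \<pi> y = \<pi> (x \<otimes>\<^bsub>A\<^esub> y)" "\<pi> x \<oplus>\<^bsub>B\<^esub> \<pi> y = \<pi> (x \<oplus>\<^bsub>A\<^esub> y)"
      "\<pi>' x \<otimes>\<^bsub>C\<^esub> \<pi>' y = \<pi>' (x \<otimes>\<^bsub>A\<^esub> y)" "\<pi>' x \<oplus>\<^bsub>C\<^esub> \<pi>' y = \<pi>' (x \<oplus>\<^bsub>A\<^esub> y)"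
    if "x \<in> carrier A" "y \<in> carrier A" for x y
    using that \<pi> \<pi>' by (auto simp: star_hom_def ring_hom_def)
  have ops1: "scale B c (\<pi> x) = \<pi> (scale A c x)" "star B (\<pi> x) = \<pi> (star A x)"
      "scale C c (\<pi>' x) = \<pi>' (scale A c x)" "star C (\<pi>' x) = \<pi>' (star A x)" "\<pi>' x \<in> carrier C"
    if "x \<in> carrier A" for x c
    using that \<pi> \<pi>' by (auto simp: star_hom_def ring_hom_def)
  have ones: "\<pi> \<one>\<^bsub>A\<^esub> = \<one>\<^bsub>B\<^esub>" "\<pi>' \<one>\<^bsub>A\<^esub> = \<one>\<^bsub>C\<^esub>"
    using \<pi> \<pi>' by (auto simp: star_hom_def ring_hom_def)
  have "\<psi> \<in> ring_hom B C"
  proof (rule ring_hom_memI)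
    fix b b' assume "b \<in> carrier B" "b' \<in> carrier B"
    then obtain x y where "x \<in> carrier A" "b = \<pi> x" "y \<in> carrier A" "b' = \<pi> y"
      using \<pi>(2) by blast
    then show "\<psi> b \<in> carrier C" "\<psi> (b \<otimes>\<^bsub>B\<^esub> b') = \<psi> b \<otimes>\<^bsub>C\<^esub> \<psi> b'"
      "\<psi> (b \<oplus>\<^bsub>B\<^esub> b') = \<psi> b \<oplus>\<^bsub>C\<^esub> \<psi> b'"
      by (simp_all add: ops ops1 \<psi>)
  next
    show "\<psi> \<one>\<^bsub>B\<^esub> = \<one>\<^bsub>C\<^esub>"
      using \<psi>[OF A.one_closed] by (simp add: ones)
  qed
  moreover have "(\<forall>c. \<psi> (scale B c b) = scale C c (\<psi> b)) \<and> \<psi> (star B b) = star C (\<psi> b)"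
    if b: "b \<in> carrier B" for b
  proof -
    obtain x where "x \<in> carrier A" "b = \<pi> x"
      using b \<pi>(2) by blast
    then show ?thesis
      by (simp add: ops1 \<psi> A.scale_closed A.star_closed)
  qed
  moreover have "bij_betw \<psi> (carrier B) (carrier C)"
    unfolding bij_betw_def
  proof
    show "inj_on \<psi> (carrier B)"
      unfolding inj_on_def \<pi>(2)[symmetric] by (simp add: \<psi> same)
    show "\<psi> ` carrier B = carrier C"
      unfolding \<pi>(2)[symmetric] \<pi>'(2)[symmetric] image_image by (simp add: \<psi> cong: image_cong)
  qed
  ultimately show "\<psi> \<in> star_iso B C"
    by (simp add: star_iso_def star_hom_def)
qed

lemma presented_class_hom: "presented_class R \<in> star_hom free_star_algebra (presented R)"
  and presented_class_surj: "range (presented_class R) = carrier (presented R)"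
proof -
  interpret F: unital_star_algebra "free_star_algebra :: 'a free star_algebra"
    by (rule unital_star_algebra_free)
  have *: "ideal (free_ideal R) free_star_algebra"
    "star free_star_algebra ` free_ideal R \<subseteq> free_ideal R"
    using free_star_ideal_generated unfolding free_star_ideal_iff by blast+
  have eq: "presented_class R = (\<lambda>x. free_ideal R +>\<^bsub>free_star_algebra\<^esub> x)"
    by (simp add: presented_class_def fun_eq_iff)
  show "presented_class R \<in> star_hom free_star_algebra (presented R)"
    "range (presented_class R) = carrier (presented R)"
    using F.quotient_projection[OF *] unfolding presented_def eq by (simp_all add: free_star_algebra_simps)
qed

lemma presented_class_eq_iff: "presented_class R x = presented_class R y \<longleftrightarrow> cong_mod (free_ideal R) x y"
proof -
  interpret F: unital_star_algebra "free_star_algebra :: 'a free star_algebra"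
    by (rule unital_star_algebra_free)
  have "ideal (free_ideal R) free_star_algebra"
    using free_star_ideal_generated unfolding free_star_ideal_iff by blast
  from F.quotient_eq_iff_same_a_r_cos[OF this, of x y] show ?thesis
    by (simp add: presented_class_def cong_mod_def a_minus_free free_star_algebra_simps)
qed

lemma presented_class_simps:
  "presented_class R x \<in> carrier (presented R)"
  "\<one>\<^bsub>presented R\<^esub> = presented_class R 1"
  "presented_class R x \<oplus>\<^bsub>presented R\<^esub> presented_class R y = presented_class R (x + y)"
  "presented_class R x \<otimes>\<^bsub>presented R\<^esub> presented_class R y = presented_class R (x * y)"
  "scale (presented R) c (presented_class R x) = presented_class R (fscale c x)"
  "star (presented R) (presented_class R x) = presented_class R (fstar x)"
  using presented_class_hom[of R]
  by (auto simp: star_hom_def ring_hom_def free_star_algebra_simps)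

lemma presented_class_zero: "\<zero>\<^bsub>presented R\<^esub> = presented_class R 0"
proof -
  interpret Q: unital_star_algebra "presented R"
    by (rule unital_star_algebra_presented)
  have "presented_class R 0 \<oplus>\<^bsub>presented R\<^esub> presented_class R 0 = presented_class R 0"
    by (simp add: presented_class_simps)
  then show ?thesis
    using Q.add.l_cancel_one' presented_class_simps(1) Q.add.r_cancel_one by (metis Q.zero_closed)
qed

lemma presented_class_sum:
  "finite I \<Longrightarrow> (\<Oplus>\<^bsub>presented R\<^esub>i\<in>I. presented_class R (f i)) = presented_class R (sum f I)"
proof (induction I rule: finite_induct)
  interpret Q: unital_star_algebra "presented R"
    by (rule unital_star_algebra_presented)
  case empty
  show ?case by (simp add: presented_class_zero)
next
  interpret Q: unital_star_algebra "presented R"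
    by (rule unital_star_algebra_presented)
  case (insert i I)
  then show ?case
    by (simp add: Q.finsum_insert presented_class_simps Pi_iff)
qed

text \<open>Imposing relations in two stages amounts to imposing them at once, because both preimages and
  images of star-ideals under the projection are star-ideals.\<close>

lemma class_mem_star_ideal_iff:
  "presented_class R x \<in> star_ideal (presented R) (presented_class R ` X) \<longleftrightarrow>
    x \<in> free_ideal (R \<union> X)"
proof
  let ?c = "presented_class R" and ?Q = "presented R"
  interpret Q: unital_star_algebra ?Q
    by (rule unital_star_algebra_presented)
  interpret J: free_star_ideal "free_ideal (R \<union> X)"
    by (rule free_star_ideal_generated)
  have neg: "\<ominus>\<^bsub>?Q\<^esub> ?c x = ?c (- x)" for x
    by (rule Q.minus_equality) (simp_all add: presented_class_simps presented_class_zero)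
  let ?K = "?c ` free_ideal (R \<union> X)"
  have "ideal ?K ?Q"
  proof (rule idealI)
    show "subgroup ?K (add_monoid ?Q)"
      by (rule Q.add.subgroupI)
        (use J.zero_mem in \<open>auto simp: presented_class_simps neg J.minus_mem J.add_mem\<close>)
  qed (auto simp: presented_class_simps J.mult_left_mem J.mult_right_mem Q.ring_axioms
      simp flip: presented_class_surj)
  moreover have "star ?Q ` ?K \<subseteq> ?K"
    by (auto simp: presented_class_simps J.star_mem)
  moreover have "?c ` X \<subseteq> ?K"
    using free_ideal_generators[of "R \<union> X"] by blast
  moreover assume "?c x \<in> star_ideal ?Q (?c ` X)"
  ultimately have "?c x \<in> ?K"
    by (meson star_ideal_least subsetD)
  then obtain y where "y \<in> free_ideal (R \<union> X)" and "cong_mod (free_ideal R) x y"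
    by (auto simp: presented_class_eq_iff)
  moreover have "free_ideal R \<subseteq> free_ideal (R \<union> X)"
    using free_ideal_subset_iff[OF J.free_star_ideal_axioms] free_ideal_generators[of "R \<union> X"]
    by blast
  ultimately show "x \<in> free_ideal (R \<union> X)"
    using J.add_mem[of "x - y" y] by (auto simp: cong_mod_def)
next
  let ?c = "presented_class R" and ?Q = "presented R"
  interpret Q: unital_star_algebra ?Q
    by (rule unital_star_algebra_presented)
  let ?I = "star_ideal ?Q (?c ` X)"
  have X: "?c ` X \<subseteq> carrier ?Q"
    by (auto simp: presented_class_simps)
  interpret I: ideal ?I ?Q
    by (rule Q.ideal_star_ideal[OF X])
  have star: "star ?Q i \<in> ?I" if "i \<in> ?I" for i
    using that Q.star_ideal_star_closed by blast
  have J: "free_star_ideal (?c -` ?I)"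
  proof
    show "0 \<in> ?c -` ?I"
      using additive_subgroup.zero_closed[OF I.additive_subgroup_axioms] by (simp add: presented_class_zero)
    show "x + y \<in> ?c -` ?I" if "x \<in> ?c -` ?I" "y \<in> ?c -` ?I" for x y
      using that additive_subgroup.a_closed[OF I.additive_subgroup_axioms, of "?c x" "?c y"] by (simp add: presented_class_simps)
    show "a * x \<in> ?c -` ?I" "x * a \<in> ?c -` ?I" if "x \<in> ?c -` ?I" for x a
      using that I.I_l_closed[of "?c x" "?c a"] I.I_r_closed[of "?c x" "?c a"]
      by (simp_all add: presented_class_simps)
    show "fstar x \<in> ?c -` ?I" if "x \<in> ?c -` ?I" for x
      using that star[of "?c x"] by (simp add: presented_class_simps)
  qed
  have "?c r = \<zero>\<^bsub>?Q\<^esub>" if "r \<in> R" for r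
    using that free_ideal_generators[of R]
    by (auto simp: presented_class_zero presented_class_eq_iff cong_mod_def)
  then have "R \<subseteq> ?c -` ?I"
    using additive_subgroup.zero_closed[OF I.additive_subgroup_axioms] by auto
  moreover have "X \<subseteq> ?c -` ?I"
    using star_ideal_generators by (rule image_subset_iff_subset_vimage[THEN iffD1])
  moreover assume "x \<in> free_ideal (R \<union> X)"
  ultimately show "?c x \<in> ?I"
    using free_ideal_least[OF J, of "R \<union> X"] by blast
qed

text \<open>The projection of the free star-algebra onto the iterated quotient identifies the same
  elements as its projection onto \<open>presented R'\<close>.\<close>

lemma quotient_of_presented:
  assumes "free_ideal (R \<union> X) = free_ideal R'"
  shows "\<exists>\<psi>\<in>star_iso (star_quotient (presented R) (star_ideal (presented R) (presented_class R ` X)))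
      (presented R').
    \<forall>x. \<psi> (star_ideal (presented R) (presented_class R ` X) +>\<^bsub>presented R\<^esub> presented_class R x) =
      presented_class R' x"
proof -
  let ?c = "presented_class R" and ?Q = "presented R"
  interpret Q: unital_star_algebra ?Q
    by (rule unital_star_algebra_presented)
  let ?I = "star_ideal ?Q (?c ` X)"
  have I: "ideal ?I ?Q"
    by (rule Q.ideal_star_ideal) (auto simp: presented_class_simps)
  note proj = Q.quotient_projection[OF I Q.star_ideal_star_closed]
  have neg: "\<ominus>\<^bsub>?Q\<^esub> ?c x = ?c (- x)" for x
    by (rule Q.minus_equality) (simp_all add: presented_class_simps presented_class_zero)
  have eq: "?I +>\<^bsub>?Q\<^esub> ?c x = ?I +>\<^bsub>?Q\<^esub> ?c y \<longleftrightarrow> presented_class R' x = presented_class R' y" for x y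
  proof -
    have "?I +>\<^bsub>?Q\<^esub> ?c x = ?I +>\<^bsub>?Q\<^esub> ?c y \<longleftrightarrow> ?c x \<ominus>\<^bsub>?Q\<^esub> ?c y \<in> ?I"
      using Q.quotient_eq_iff_same_a_r_cos[OF I] by (simp add: presented_class_simps)
    also have "?c x \<ominus>\<^bsub>?Q\<^esub> ?c y = ?c (x - y)"
      by (simp add: a_minus_def neg presented_class_simps)
    finally show ?thesis
      unfolding class_mem_star_ideal_iff assms presented_class_eq_iff cong_mod_def .
  qed
  have "\<exists>\<psi>\<in>star_iso (star_quotient ?Q ?I) (presented R').
      \<forall>x\<in>carrier free_star_algebra. \<psi> (((\<lambda>y. ?I +>\<^bsub>?Q\<^esub> y) \<circ> ?c) x) = presented_class R' x"
  proof (rule star_iso_of_same_kernel)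
    show "((\<lambda>y. ?I +>\<^bsub>?Q\<^esub> y) \<circ> ?c) \<in> star_hom free_star_algebra (star_quotient ?Q ?I)"
      by (rule star_hom_comp[OF presented_class_hom proj(1)])
    show "((\<lambda>y. ?I +>\<^bsub>?Q\<^esub> y) \<circ> ?c) ` carrier free_star_algebra = carrier (star_quotient ?Q ?I)"
      unfolding proj(2)[symmetric] by (simp add: free_star_algebra_simps image_comp flip: presented_class_surj)
    show "presented_class R' ` carrier free_star_algebra = carrier (presented R')"
      by (simp add: free_star_algebra_simps presented_class_surj)
  qed (simp_all add: eq presented_class_hom unital_star_algebra_free)
  then show ?thesis
    by (simp add: free_star_algebra_simps)
qed


section \<open>Substitution\<close>

text \<open>\<open>subst f\<close> is the star-homomorphism of free star-algebras that sends each generator \<open>g\<close> to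
  \<open>f g\<close>.\<close>

fun letter_subst :: "('g \<Rightarrow> 'h free) \<Rightarrow> 'g letter \<Rightarrow> 'h free"
  where
    "letter_subst f (Gen g) = f g"
  | "letter_subst f (GenStar g) = fstar (f g)"

definition word_subst :: "('g \<Rightarrow> 'h free) \<Rightarrow> 'g star_word \<Rightarrow> 'h free"
  where "word_subst f w = prod_list (map (letter_subst f) (letters w))"

definition subst :: "('g \<Rightarrow> 'h free) \<Rightarrow> 'g free \<Rightarrow> 'h free"
  where "subst f x =
    (\<Sum>w\<in>Poly_Mapping.keys x. fscale (Poly_Mapping.lookup x w) (word_subst f w))"

lemma fscale_0 [simp]: "fscale 0 x = 0" "fscale c 0 = 0"
  by (simp_all add: fscale_def)

lemma fscale_sum: "fscale c (sum f I) = (\<Sum>i\<in>I. fscale c (f i))"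
  by (simp add: fscale_def sum_distrib_left)

lemma fstar_one [simp]: "fstar 1 = 1"
  unfolding one_poly_mapping.abs_eq[symmetric] single_one[symmetric] fstar_single
  by (simp add: word_star_def zero_star_word_def)

lemma fstar_uminus: "fstar (- x) = - fstar x"
  by (rule poly_mapping_eqI) (simp add: lookup_fstar)

lemma subst_superset:
  assumes "finite K" "Poly_Mapping.keys x \<subseteq> K"
  shows "subst f x = (\<Sum>w\<in>K. fscale (Poly_Mapping.lookup x w) (word_subst f w))"
  unfolding subst_def by (rule sum.mono_neutral_left) (use assms in \<open>auto simp: in_keys_iff\<close>)

lemma subst_add: "subst f (x + y) = subst f x + subst f y"
proof -
  let ?K = "Poly_Mapping.keys x \<union> Poly_Mapping.keys y"
  have "subst f z = (\<Sum>w\<in>?K. fscale (Poly_Mapping.lookup z w) (word_subst f w))"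
    if "z \<in> {x, y, x + y}" for z
    by (rule subst_superset) (use that keys_add[of x y] in auto)
  then show ?thesis
    by (simp add: lookup_add fscale_simps sum.distrib)
qed

lemma subst_0 [simp]: "subst f 0 = 0"
  by (simp add: subst_def)

lemma subst_sum: "subst f (sum g I) = (\<Sum>i\<in>I. subst f (g i))"
  by (induction I rule: infinite_finite_induct) (simp_all add: subst_add)

lemma subst_single: "subst f (Poly_Mapping.single w c) = fscale c (word_subst f w)"
  by (cases "c = 0") (simp_all add: subst_def)

lemma word_subst_plus: "word_subst f (v + w) = word_subst f v * word_subst f w"
  by (simp add: word_subst_def plus_star_word_def)

lemma subst_mult: "subst f (x * y) = subst f x * subst f y"
proof -
  let ?s = "\<lambda>x. \<Sum>w\<in>Poly_Mapping.keys x. Poly_Mapping.single w (Poly_Mapping.lookup x w)"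
  have "subst f (?s x * ?s y) = subst f (?s x) * subst f (?s y)"
    unfolding sum_product subst_sum mult_single subst_single word_subst_plus
    by (simp add: fscale_simps fscale_mult_right mult.commute)
  then show ?thesis
    by (simp flip: free_eq_sum)
qed

lemma word_subst_star: "word_subst f (word_star w) = fstar (word_subst f w)"
proof -
  have "letter_subst f (letter_star l) = fstar (letter_subst f l)" for l
    by (cases l) (auto simp: fstar_fstar)
  then have "prod_list (map (letter_subst f) (rev (map letter_star ls))) =
      fstar (prod_list (map (letter_subst f) ls))" for ls
    by (induction ls) (simp_all add: fstar_mult)
  then show ?thesis
    by (simp add: word_subst_def word_star_def)
qed

lemma subst_fstar: "subst f (fstar x) = fstar (subst f x)"
  unfolding fstar_def[of x] subst_sum subst_single word_subst_star
  by (simp add: subst_def fstar_sum fstar_fscale)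

lemma subst_one [simp]: "subst f 1 = 1"
  unfolding single_one[symmetric] subst_single
  by (simp add: word_subst_def zero_star_word_def[symmetric] fscale_simps) (simp add: zero_star_word_def)

lemma subst_fscale: "subst f (fscale c x) = fscale c (subst f x)"
  unfolding fscale_def subst_mult subst_single
  by (simp add: word_subst_def zero_star_word_def)

lemma subst_uminus: "subst f (- x) = - subst f x"
  using subst_add[of f x "- x"] by (simp add: eq_neg_iff_add_eq_0 add.commute)

lemma subst_diff: "subst f (x - y) = subst f x - subst f y"
  using subst_add[of f x "- y"] by (simp add: subst_uminus)

lemma subst_gen [simp]: "subst f (gen g) = f g"
  by (simp add: gen_def subst_single word_subst_def fscale_simps)

lemmas subst_simps = subst_add subst_diff subst_uminus subst_sum subst_mult subst_fstar subst_fscale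

lemma subst_star_hom: "subst f \<in> star_hom free_star_algebra free_star_algebra"
  by (simp add: star_hom_def ring_hom_def free_star_algebra_simps subst_simps)

text \<open>Thus a statement about all star-ideals of one free star-algebra can be used to recognise
  substitutions into another that respect given relations.\<close>

lemma free_star_ideal_vimage:
  assumes "free_star_ideal J"
  shows "free_star_ideal (subst f -` J)"
proof -
  interpret free_star_ideal J by fact
  show ?thesis
    by unfold_locales (auto simp: subst_simps zero_mem add_mem mult_left_mem mult_right_mem star_mem)
qed

lemma cong_mod_vimage: "cong_mod (subst f -` J) x y \<longleftrightarrow> cong_mod J (subst f x) (subst f y)"
  by (simp add: cong_mod_def subst_diff)

lemma subst_mem_free_ideal:
  assumes "free_star_ideal J" "subst f ` R \<subseteq> J" "x \<in> free_ideal R"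
  shows "subst f x \<in> J"
  using free_ideal_least[OF free_star_ideal_vimage[OF assms(1)], of R f] assms by blast

lemma subst_subst: "subst f (subst h x) = subst (\<lambda>g. subst f (h g)) x"
proof -
  have "subst f (letter_subst h l) = letter_subst (\<lambda>g. subst f (h g)) l" for l
    by (cases l) (simp_all add: subst_fstar)
  then have "subst f (prod_list (map (letter_subst h) ls)) =
      prod_list (map (letter_subst (\<lambda>g. subst f (h g))) ls)" for ls
    by (induction ls) (simp_all add: subst_mult)
  then have "subst f (word_subst h w) = word_subst (\<lambda>g. subst f (h g)) w" for w
    by (simp add: word_subst_def)
  then show ?thesis
    by (simp add: subst_def[of h] subst_def[of "\<lambda>g. subst f (h g)"] subst_sum subst_fscale)
qed

text \<open>An endomorphism that fixes the generators up to congruence fixes everything up to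
  congruence, because words are products of generators and their adjoints.\<close>

lemma subst_cong_id:
  assumes J: "free_star_ideal J" and gen: "\<And>g. cong_mod J (f g) (gen g)"
  shows "cong_mod J (subst f x) x"
proof -
  interpret free_star_ideal J by fact
  have letter: "letter_subst f l \<doteq> Poly_Mapping.single (Word [l]) 1" for l
  proof (cases l)
    case (Gen g)
    then show ?thesis using gen[of g] by (simp add: gen_def)
  next
    case (GenStar g)
    then show ?thesis
      using cong_star[OF gen[of g]] by (simp add: gen_def fstar_single word_star_def)
  qed
  have list: "prod_list (map (letter_subst f) ls) \<doteq> Poly_Mapping.single (Word ls) 1" for ls
  proof (induction ls)
    case Nil
    then show ?case by (simp flip: zero_star_word_def)
  next
    case (Cons l ls)
    from cong_mult[OF letter[of l] this] show ?case
      by (simp add: mult_single plus_star_word_def)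
  qed
  have word: "word_subst f w \<doteq> Poly_Mapping.single w 1" for w
    using list[of "letters w"] by (simp add: word_subst_def)
  have "subst f x \<doteq> (\<Sum>w\<in>Poly_Mapping.keys x. fscale (Poly_Mapping.lookup x w) (Poly_Mapping.single w 1))"
    unfolding subst_def by (intro cong_sum cong_scale word)
  also have "\<dots> = (\<Sum>w\<in>Poly_Mapping.keys x. Poly_Mapping.single w (Poly_Mapping.lookup x w))"
    by (simp add: fscale_def mult_single)
  also have "\<dots> = x"
    by (rule free_eq_sum[symmetric])
  finally show ?thesis .
qed

lemma subst_gen_id: "subst gen x = x"
proof -
  have "free_star_ideal {0 :: 'a free}"
    by (simp add: free_star_ideal_def fstar_zero)
  from subst_cong_id[OF this, of gen x] show ?thesis
    by (simp add: cong_mod_def)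
qed

text \<open>The substitution \<open>f\<close> induces a map between the quotients because it respects the relations.
  Modulo the relations, \<open>h\<close> is a left inverse, which makes the induced map injective, and a right
  inverse, which makes it surjective.\<close>

lemma presented_iso:
  fixes f :: "'g \<Rightarrow> 'h free" and h :: "'h \<Rightarrow> 'g free"
  assumes f: "subst f ` R \<subseteq> free_ideal R'" and h: "subst h ` R' \<subseteq> free_ideal R"
    and hf: "\<And>g. cong_mod (free_ideal R) (subst h (f g)) (gen g)"
    and fh: "\<And>k. cong_mod (free_ideal R') (subst f (h k)) (gen k)"
  shows "\<exists>\<phi>\<in>star_iso (presented R) (presented R').
    \<forall>x. \<phi> (presented_class R x) = presented_class R' (subst f x)"
proof -
  interpret J: free_star_ideal "free_ideal R" by (rule free_star_ideal_generated)
  interpret J': free_star_ideal "free_ideal R'" by (rule free_star_ideal_generated)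
  have hf_all: "cong_mod (free_ideal R) (subst h (subst f x)) x" for x
    unfolding subst_subst by (rule subst_cong_id[OF J.free_star_ideal_axioms hf])
  have fh_all: "cong_mod (free_ideal R') (subst f (subst h y)) y" for y
    unfolding subst_subst by (rule subst_cong_id[OF J'.free_star_ideal_axioms fh])
  have kernel: "cong_mod (free_ideal R) x y \<longleftrightarrow> cong_mod (free_ideal R') (subst f x) (subst f y)" for x y
  proof
    assume "cong_mod (free_ideal R) x y"
    then show "cong_mod (free_ideal R') (subst f x) (subst f y)"
      using subst_mem_free_ideal[OF J'.free_star_ideal_axioms f]
      by (simp add: cong_mod_def flip: subst_diff)
  next
    assume "cong_mod (free_ideal R') (subst f x) (subst f y)"
    then have "cong_mod (free_ideal R) (subst h (subst f x)) (subst h (subst f y))"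
      using subst_mem_free_ideal[OF J.free_star_ideal_axioms h]
      by (simp add: cong_mod_def flip: subst_diff)
    then show "cong_mod (free_ideal R) x y"
      using J.cong_cong[OF hf_all hf_all] by blast
  qed
  have "\<exists>\<phi>\<in>star_iso (presented R) (presented R').
      \<forall>x\<in>carrier free_star_algebra. \<phi> (presented_class R x) = (presented_class R' \<circ> subst f) x"
  proof (rule star_iso_of_same_kernel)
    show "presented_class R' \<circ> subst f \<in> star_hom free_star_algebra (presented R')"
      by (rule star_hom_comp[OF subst_star_hom presented_class_hom])
    have "presented_class R' y = presented_class R' (subst f (subst h y))" for y
      using J'.cong_sym[OF fh_all] by (simp add: presented_class_eq_iff)
    then show "(presented_class R' \<circ> subst f) ` carrier free_star_algebra = carrier (presented R')"
      unfolding presented_class_surj[symmetric] by (force simp: free_star_algebra_simps)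
  qed (simp_all add: presented_class_hom presented_class_surj free_star_algebra_simps
      presented_class_eq_iff kernel unital_star_algebra_free)
  then show ?thesis
    by (simp add: free_star_algebra_simps)
qed


section \<open>Systems of matrix units modulo a star-ideal\<close>

lemma fscale_sum_left: "fscale (sum f I) x = (\<Sum>i\<in>I. fscale (f i) x)"
  by (induction I rule: infinite_finite_induct) (simp_all add: fscale_simps)

text \<open>\<open>linear_extension E\<close> is the linear map on matrices that takes the values \<open>E a b\<close> on the matrix
  units.\<close>

definition linear_extension :: "('n::finite \<Rightarrow> 'n \<Rightarrow> 'g free) \<Rightarrow> complex^'n^'n \<Rightarrow> 'g free"
  where "linear_extension E x = (\<Sum>a\<in>UNIV. \<Sum>b\<in>UNIV. fscale (x $ a $ b) (E a b))"

context free_star_ideal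
begin

definition matrix_units :: "('n::finite \<Rightarrow> 'n \<Rightarrow> 'g free) \<Rightarrow> bool"
  where "matrix_units E \<longleftrightarrow>
    (\<forall>a b c d. E a b * E c d \<doteq> (if b = c then E a d else 0)) \<and>
    (\<Sum>a\<in>UNIV. E a a) \<doteq> 1 \<and>
    (\<forall>a b. fstar (E a b) \<doteq> E b a)"

end

lemma linear_extension_matrix_unit: "linear_extension E (matrix_unit a b) = E a b"
proof -
  have "linear_extension E (matrix_unit a b) =
      (\<Sum>p\<in>UNIV. \<Sum>q\<in>UNIV. if q = b then (if p = a then E p q else 0) else 0)"
    unfolding linear_extension_def
    by (intro sum.cong refl) (simp add: matrix_unit_def fscale_simps)
  then show ?thesis
    by simp
qed

lemma matrix_unit_mult:
  "matrix_unit a b ** matrix_unit c d = (if b = c then matrix_unit a d else 0)"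
proof -
  have "(\<Sum>k\<in>UNIV. matrix_unit a b $ p $ k * matrix_unit c d $ k $ q) =
      (\<Sum>k\<in>UNIV. if k = b then (if b = c \<and> p = a \<and> q = d then 1 else 0) else 0)" for p q
    by (intro sum.cong refl) (auto simp: matrix_unit_def)
  then show ?thesis
    by (simp add: vec_eq_iff matrix_matrix_mult_def) (simp add: matrix_unit_def)
qed

context free_star_ideal
begin

lemma linear_extension_cong_iff:
  "(\<forall>x. linear_extension E x \<doteq> linear_extension F x) \<longleftrightarrow> (\<forall>a b. E a b \<doteq> F a b)"
proof
  assume "\<forall>x. linear_extension E x \<doteq> linear_extension F x"
  then have "linear_extension E (matrix_unit a b) \<doteq> linear_extension F (matrix_unit a b)" for a b
    by blast
  then show "\<forall>a b. E a b \<doteq> F a b"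
    unfolding linear_extension_matrix_unit by blast
qed (auto simp: linear_extension_def intro!: cong_sum cong_scale)

lemma linear_extension_multiplicative_iff:
  "(\<forall>x y. linear_extension E (x ** y) \<doteq> linear_extension E x * linear_extension E y) \<longleftrightarrow>
    (\<forall>a b c d. E a b * E c d \<doteq> (if b = c then E a d else 0))"
proof (intro iffI allI)
  fix a b c d
  assume "\<forall>x y. linear_extension E (x ** y) \<doteq> linear_extension E x * linear_extension E y"
  then have "linear_extension E (matrix_unit a b ** matrix_unit c d) \<doteq>
      linear_extension E (matrix_unit a b) * linear_extension E (matrix_unit c d)"
    by blast
  then have "E a b * E c d \<doteq> linear_extension E (matrix_unit a b ** matrix_unit c d)"
    unfolding linear_extension_matrix_unit by (rule cong_sym)
  moreover have "linear_extension E 0 = 0"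
    by (simp add: linear_extension_def)
  ultimately show "E a b * E c d \<doteq> (if b = c then E a d else 0)"
    by (simp add: matrix_unit_mult linear_extension_matrix_unit split: if_splits)
next
  fix x y :: "complex^'a^'a"
  assume E: "\<forall>a b c d. E a b * E c d \<doteq> (if b = c then E a d else 0)"
  have "linear_extension E x * linear_extension E y =
      (\<Sum>a\<in>UNIV. \<Sum>b\<in>UNIV. \<Sum>c\<in>UNIV. \<Sum>d\<in>UNIV.
        fscale (x $ a $ b * y $ c $ d) (E a b * E c d))"
    by (simp only: linear_extension_def sum_product fscale_mult_right fscale_simps mult.commute)
      (intro sum.cong refl sum.swap)
  also have "\<dots> \<doteq> (\<Sum>a\<in>UNIV. \<Sum>b\<in>UNIV. \<Sum>c\<in>UNIV. \<Sum>d\<in>UNIV.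
      fscale (x $ a $ b * y $ c $ d) (if b = c then E a d else 0))"
    using E by (intro cong_sum cong_scale) blast
  also have "\<dots> = (\<Sum>a\<in>UNIV. \<Sum>b\<in>UNIV. \<Sum>c\<in>UNIV.
      if c = b then (\<Sum>d\<in>UNIV. fscale (x $ a $ b * y $ b $ d) (E a d)) else 0)"
    by (intro sum.cong refl) auto
  also have "\<dots> = (\<Sum>a\<in>UNIV. \<Sum>d\<in>UNIV. \<Sum>b\<in>UNIV. fscale (x $ a $ b * y $ b $ d) (E a d))"
    by simp (intro sum.cong refl sum.swap)
  also have "\<dots> = linear_extension E (x ** y)"
    by (simp add: linear_extension_def matrix_matrix_mult_def fscale_sum_left)
  finally show "linear_extension E (x ** y) \<doteq> linear_extension E x * linear_extension E y"
    by (rule cong_sym)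
qed

lemma linear_extension_star_iff:
  "(\<forall>x. linear_extension E (mstar cnj x) \<doteq> fstar (linear_extension E x)) \<longleftrightarrow>
    (\<forall>a b. fstar (E a b) \<doteq> E b a)"
proof -
  have "linear_extension E (mstar cnj x) =
      fstar (linear_extension (\<lambda>a b. fstar (E b a)) x)" for x
    unfolding linear_extension_def mstar_def fstar_sum fstar_fscale
    by (simp add: fstar_fstar) (rule sum.swap)
  then have "(\<forall>x. linear_extension E (mstar cnj x) \<doteq> fstar (linear_extension E x)) \<longleftrightarrow>
      (\<forall>x. linear_extension (\<lambda>a b. fstar (E b a)) x \<doteq> linear_extension E x)"
    using cong_star fstar_fstar by (metis (no_types, lifting))
  then show ?thesis
    unfolding linear_extension_cong_iff by blast
qed

text \<open>The relations of a bigalois extension quantify over all matrices; by linearity it suffices to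
  impose them on the matrix units.\<close>

lemma matrix_units_iff:
  "matrix_units E \<longleftrightarrow>
    (\<forall>x y. linear_extension E (x ** y) \<doteq> linear_extension E x * linear_extension E y) \<and>
    linear_extension E (mat 1) \<doteq> 1 \<and>
    (\<forall>x. linear_extension E (mstar cnj x) \<doteq> fstar (linear_extension E x))"
proof -
  have "linear_extension E (mat 1) = (\<Sum>a\<in>UNIV. \<Sum>b\<in>UNIV. if b = a then E a b else 0)"
    unfolding linear_extension_def by (intro sum.cong refl) (auto simp: mat_def fscale_simps)
  then have "linear_extension E (mat 1) = (\<Sum>a\<in>UNIV. E a a)"
    by simp
  then show ?thesis
    unfolding matrix_units_def linear_extension_multiplicative_iff linear_extension_star_iff by simp
qed

lemma matrix_units_cong:
  assumes "matrix_units E" and F: "\<And>a b. F a b \<doteq> E a b"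
  shows "matrix_units F"
  unfolding matrix_units_def
proof (intro conjI allI)
  have E: "E a b * E c d \<doteq> (if b = c then E a d else 0)" "(\<Sum>a\<in>UNIV. E a a) \<doteq> 1"
    "fstar (E a b) \<doteq> E b a" for a b c d
    using assms(1) by (auto simp: matrix_units_def)
  show "F a b * F c d \<doteq> (if b = c then F a d else 0)" for a b c d
  proof -
    have "F a b * F c d \<doteq> E a b * E c d" by (intro cong_mult F)
    also note E(1)
    also have "(if b = c then E a d else 0) \<doteq> (if b = c then F a d else 0)"
      using cong_sym[OF F] by simp
    finally show ?thesis .
  qed
  show "(\<Sum>a\<in>UNIV. F a a) \<doteq> 1"
    using cong_trans[OF cong_sum[OF F] E(2)] by simp
  show "fstar (F a b) \<doteq> F b a" for a b
    using cong_trans[OF cong_star[OF F] cong_trans[OF E(3) cong_sym[OF F]]] .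
qed


section \<open>Matrix units of a partial isometry\<close>

text \<open>A partial isometry whose initial and final projections are complementary.\<close>

definition half_isometry :: "'g free \<Rightarrow> bool"
  where "half_isometry s \<longleftrightarrow> s * fstar s * s \<doteq> s \<and> s * fstar s + fstar s * s \<doteq> 1"

end

definition units_of_isometry :: "'g free \<Rightarrow> 2 \<Rightarrow> 2 \<Rightarrow> 'g free"
  where "units_of_isometry s a b =
    (if a = 1 then (if b = 1 then s * fstar s else s)
     else (if b = 1 then fstar s else fstar s * s))"

context free_star_ideal
begin

text \<open>Inserting \<open>1 = s s\<^sup>* + s\<^sup>* s\<close> between the two factors of \<open>s s\<close> gives \<open>s s = 2 s s\<close>.\<close>

lemma half_isometry_square:
  assumes "half_isometry s"
  shows "s * s \<doteq> 0"
proof -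
  have iso: "s * fstar s * s \<doteq> s" and sum: "s * fstar s + fstar s * s \<doteq> 1"
    using assms by (auto simp: half_isometry_def)
  have "s * s = s * 1 * s" by simp
  also have "\<dots> \<doteq> s * (s * fstar s + fstar s * s) * s"
    by (intro cong_mult cong_refl cong_sym[OF sum])
  also have "\<dots> = s * (s * fstar s * s) + (s * fstar s * s) * s"
    by (simp add: algebra_simps)
  also have "\<dots> \<doteq> s * s + s * s"
    by (intro cong_add cong_mult cong_refl iso)
  finally have "s * s - (s * s + s * s) \<in> J"
    by (simp add: cong_mod_def)
  then show ?thesis
    using minus_mem by (fastforce simp: cong_mod_def)
qed

text \<open>A product of units is a word in \<open>s\<close> and \<open>s\<^sup>*\<close>: it vanishes as soon as a letter is repeated, and
  an alternating word contracts to one of length at most two.\<close>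

lemma matrix_units_of_half_isometry:
  assumes "half_isometry s"
  shows "matrix_units (units_of_isometry s)"
proof -
  define t where "t = fstar s"
  have t: "fstar s = t" "fstar t = s"
    by (simp_all add: t_def fstar_fstar)
  have sts: "s * (t * s) \<doteq> s" and sum: "s * t + t * s \<doteq> 1"
    using assms by (auto simp: half_isometry_def t mult.assoc)
  have tst: "t * (s * t) \<doteq> t"
    using cong_star[OF sts] by (simp add: fstar_mult t mult.assoc)
  have ss: "s * s \<doteq> 0"
    by (rule half_isometry_square[OF assms])
  have tt: "t * t \<doteq> 0"
    using cong_star[OF ss] by (simp add: fstar_mult t fstar_zero)
  have prod: "s * (t * (s * t)) \<doteq> s * t" "t * (s * (t * s)) \<doteq> t * s"
    by (intro cong_mult cong_refl tst sts)+
  have left: "s * (s * x) \<doteq> 0" "t * (t * x) \<doteq> 0" for x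
    using cong_mult[OF ss cong_refl[of x]] cong_mult[OF tt cong_refl[of x]]
    by (simp_all add: mult.assoc)
  have right: "x * (s * s) \<doteq> 0" "x * (t * t) \<doteq> 0" "x * (s * (s * y)) \<doteq> 0" "x * (t * (t * y)) \<doteq> 0" for x y
    using cong_mult[OF cong_refl[of x] ss] cong_mult[OF cong_refl[of x] tt]
      cong_mult[OF cong_refl[of x] left(1)[of y]] cong_mult[OF cong_refl[of x] left(2)[of y]]
    by simp_all
  show ?thesis
    unfolding matrix_units_def forall_2 sum_2
    using sts tst sum ss tt prod left right
    by (simp add: units_of_isometry_def t fstar_mult mult.assoc)
qed

lemma matrix_units_2_iff:
  fixes E :: "2 \<Rightarrow> 2 \<Rightarrow> 'g free"
  shows "matrix_units E \<longleftrightarrow>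
    half_isometry (E 1 2) \<and> (\<forall>a b. E a b \<doteq> units_of_isometry (E 1 2) a b)"
proof
  assume "matrix_units E"
  then have mult: "E a b * E c d \<doteq> (if b = c then E a d else 0)"
    and one: "E 1 1 + E 2 2 \<doteq> 1" and star: "fstar (E a b) \<doteq> E b a" for a b c d
    by (auto simp: matrix_units_def sum_2)
  have 11: "E 1 2 * fstar (E 1 2) \<doteq> E 1 1"
    using cong_trans[OF cong_mult[OF cong_refl[of "E 1 2"] star[of 1 2]] mult[of 1 2 2 1]] by simp
  have 22: "fstar (E 1 2) * E 1 2 \<doteq> E 2 2"
    using cong_trans[OF cong_mult[OF star[of 1 2] cong_refl[of "E 1 2"]] mult[of 2 1 1 2]] by simp
  have "E 1 2 * fstar (E 1 2) * E 1 2 \<doteq> E 1 2"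
    using cong_trans[OF cong_mult[OF 11 cong_refl[of "E 1 2"]] mult[of 1 1 1 2]] by simp
  moreover have "E 1 2 * fstar (E 1 2) + fstar (E 1 2) * E 1 2 \<doteq> 1"
    using cong_trans[OF cong_add[OF 11 22] one] .
  ultimately show "half_isometry (E 1 2) \<and> (\<forall>a b. E a b \<doteq> units_of_isometry (E 1 2) a b)"
    using cong_sym[OF 11] cong_sym[OF 22] cong_sym[OF star[of 1 2]]
    by (simp add: half_isometry_def forall_2 units_of_isometry_def)
next
  assume "half_isometry (E 1 2) \<and> (\<forall>a b. E a b \<doteq> units_of_isometry (E 1 2) a b)"
  then show "matrix_units E"
    using matrix_units_cong[OF matrix_units_of_half_isometry] by blast
qed

end


section \<open>The relations of the bigalois extension modulo a star-ideal\<close>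

lemma fscale_2: "fscale 2 x = 2 * x"
  using fscale_simps(1)[of 1 1 x] by (simp add: fscale_simps mult_2)

text \<open>The position of the matrix unit \<open>e\<^sub>a\<^sub>b\<close> in the basis \<open>M2_basis\<close>.\<close>

definition M2_index :: "2 \<Rightarrow> 2 \<Rightarrow> 4"
  where "M2_index a b = (if a = 1 then (if b = 1 then 1 else 2) else (if b = 1 then 3 else 4))"

lemma vector_4:
  "(vector [w, x, y, z] :: 'a::zero^4) $ 1 = w"
  "(vector [w, x, y, z] :: 'a::zero^4) $ 2 = x"
  "(vector [w, x, y, z] :: 'a::zero^4) $ 3 = y"
  "(vector [w, x, y, z] :: 'a::zero^4) $ 4 = z"
  by (simp_all add: vector_def)

text \<open>The second graph on \<open>\<complex>\<^sup>4\<close> has the two cliques \<open>{1, 2}\<close> and \<open>{3, 4}\<close>.\<close>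

definition same_pair :: "4 \<Rightarrow> 4 \<Rightarrow> bool"
  where "same_pair k l \<longleftrightarrow> (k \<in> {1, 2} \<longleftrightarrow> l \<in> {1, 2})"

lemma M2_adj_entries:
  "M2_adj 1 $ M2_index a b $ M2_index c e = (if a = c \<and> b = e then 1 else 0)"
  "M2_adj 2 $ M2_index a b $ M2_index c e = (if a = b \<and> b = c \<and> c = e then 2 else 0)"
  "M2_adj 4 $ M2_index a b $ M2_index c e = (if a = b \<and> c = e then 2 else 0)"
proof -
  have "\<forall>a b c e. M2_adj 1 $ M2_index a b $ M2_index c e = (if a = c \<and> b = e then 1 else 0)"
    by (simp add: forall_2 M2_adj_def M2_index_def mat_def)
  moreover have "\<forall>a b c e. M2_adj 2 $ M2_index a b $ M2_index c e =
      (if a = b \<and> b = c \<and> c = e then 2 else 0)"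
    by (simp add: forall_2 M2_adj_def M2_index_def vector_4)
  moreover have "\<forall>a b c e. M2_adj 4 $ M2_index a b $ M2_index c e = (if a = b \<and> c = e then 2 else 0)"
    by (simp add: forall_2 M2_adj_def M2_index_def vector_4)
  ultimately show
    "M2_adj 1 $ M2_index a b $ M2_index c e = (if a = c \<and> b = e then 1 else 0)"
    "M2_adj 2 $ M2_index a b $ M2_index c e = (if a = b \<and> b = c \<and> c = e then 2 else 0)"
    "M2_adj 4 $ M2_index a b $ M2_index c e = (if a = b \<and> c = e then 2 else 0)"
    by blast+
qed

lemma C4_adj_entries:
  "C4_adj 1 $ k $ l = (if k = l then 1 else 0)"
  "C4_adj 2 $ k $ l = (if same_pair k l then 1 else 0)"
  "C4_adj 4 $ k $ l = 1"
proof -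
  have "\<forall>k l. C4_adj 2 $ k $ l = (if same_pair k l then 1 else 0)"
    by (simp add: forall_4 C4_adj_def vector_4 same_pair_def)
  moreover have "\<forall>k l. C4_adj 4 $ k $ l = 1"
    by (simp add: forall_4 C4_adj_def vector_4)
  ultimately show "C4_adj 2 $ k $ l = (if same_pair k l then 1 else 0)" "C4_adj 4 $ k $ l = 1"
    by blast+
qed (simp add: C4_adj_def mat_def)

lemmas adjacency_entries = M2_adj_entries C4_adj_entries

text \<open>The same linear relation holds on both sides, so an intertwiner of the first, second and fourth
  adjacency matrices intertwines the third.\<close>

lemma adjacency_3:
  "M2_adj 3 = M2_adj 4 - M2_adj 2 + M2_adj 1" "C4_adj 3 = C4_adj 4 - C4_adj 2 + C4_adj 1"
  by (simp_all add: vec_eq_iff forall_4 M2_adj_def C4_adj_def vector_4 mat_def)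

context free_star_ideal
begin

text \<open>Unitarity of the matrix \<open>(P\<^sub>i\<^sup>k)\<close> in terms of \<open>E k a b = \<surd>2 P\<^sub>i\<^sup>k\<close> with \<open>i\<close> the position of \<open>e\<^sub>a\<^sub>b\<close>;
  the two factors \<open>\<surd>2\<close> turn the entries \<open>1\<close> of the identity matrix into \<open>2\<close>.\<close>

definition bi_unitary :: "(4 \<Rightarrow> 2 \<Rightarrow> 2 \<Rightarrow> 'g free) \<Rightarrow> bool"
  where "bi_unitary E \<longleftrightarrow>
    (\<forall>a b c e. (\<Sum>k\<in>UNIV. fstar (E k a b) * E k c e) \<doteq> (if a = c \<and> b = e then 2 else 0)) \<and>
    (\<forall>k l. (\<Sum>a\<in>UNIV. \<Sum>b\<in>UNIV. E k a b * fstar (E l a b)) \<doteq> (if k = l then 2 else 0))"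

definition intertwiner_defect :: "nat \<Rightarrow> (4 \<Rightarrow> 2 \<Rightarrow> 2 \<Rightarrow> 'g free) \<Rightarrow> 4 \<Rightarrow> 2 \<Rightarrow> 2 \<Rightarrow> 'g free"
  where "intertwiner_defect d E k c e =
    (\<Sum>a\<in>UNIV. \<Sum>b\<in>UNIV. fscale (M2_adj d $ M2_index a b $ M2_index c e) (E k a b)) -
    (\<Sum>l\<in>UNIV. fscale (C4_adj d $ k $ l) (E l c e))"

definition intertwines :: "nat \<Rightarrow> (4 \<Rightarrow> 2 \<Rightarrow> 2 \<Rightarrow> 'g free) \<Rightarrow> bool"
  where "intertwines d E \<longleftrightarrow> (\<forall>k c e. intertwiner_defect d E k c e \<doteq> 0)"

text \<open>The relations between the generators \<open>S\<^sub>r\<close> of \<open>\<O>\<^sub>1\<close>, imposed modulo \<open>J\<close> on elements \<open>s r\<close>.\<close>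

definition balanced_isometries :: "(4 \<Rightarrow> 'g free) \<Rightarrow> bool"
  where "balanced_isometries s \<longleftrightarrow>
    (\<forall>r. half_isometry (s r)) \<and>
    (\<Sum>r\<in>UNIV. fstar (s r) * s r) \<doteq> 2 \<and> (\<Sum>r\<in>UNIV. s r) \<doteq> 0 \<and>
    (\<forall>q r. q \<noteq> r \<longrightarrow> fstar (s q) * s r + fstar (s q) * s q * fstar (s r) * s r \<doteq> 0)"

lemma matrix_unitsD:
  assumes "matrix_units E"
  shows "E a b * E c d \<doteq> (if b = c then E a d else 0)" "fstar (E a b) \<doteq> E b a"
    and matrix_units_unit: "(\<Sum>a\<in>UNIV. E a a) \<doteq> 1"
  using assms by (auto simp: matrix_units_def)

text \<open>The matrix unit relations reduce \<open>(E k a b)\<^sup>* E k c e\<close> to \<open>E k b e\<close> or \<open>0\<close>, so only the sums of the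
  \<open>E k b e\<close> over \<open>k\<close> matter. Two of them suffice: those at \<open>(1,2)\<close> and \<open>(2,1)\<close> are adjoint to each
  other, and those at \<open>(1,1)\<close> and \<open>(2,2)\<close> add up to \<open>4\<close>.\<close>

lemma column_isometry_iff:
  assumes E: "\<And>k::4. matrix_units (E k :: 2 \<Rightarrow> 2 \<Rightarrow> 'g free)"
  shows "(\<forall>a b c e. (\<Sum>k\<in>UNIV. fstar (E k a b) * E k c e) \<doteq> (if a = c \<and> b = e then 2 else 0)) \<longleftrightarrow>
    (\<Sum>k\<in>UNIV. E k 1 2) \<doteq> 0 \<and> (\<Sum>k\<in>UNIV. E k 2 2) \<doteq> 2"
proof -
  have prod: "(\<Sum>k\<in>UNIV. fstar (E k a b) * E k c e) \<doteq> (\<Sum>k\<in>UNIV. if a = c then E k b e else 0)"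
    for a b c e
    by (intro cong_sum cong_trans[OF cong_mult[OF matrix_unitsD(2)[OF E] cong_refl]
        matrix_unitsD(1)[OF E]])
  have entry: "(\<Sum>k\<in>UNIV. fstar (E k a b) * E k c e) \<doteq> (if a = c \<and> b = e then 2 else 0) \<longleftrightarrow>
      (a = c \<longrightarrow> (\<Sum>k\<in>UNIV. E k b e) \<doteq> (if b = e then 2 else 0))" for a b c e
    unfolding cong_cong[OF prod cong_refl] by (cases "a = c") simp_all
  have "(\<forall>a b c e. (\<Sum>k\<in>UNIV. fstar (E k a b) * E k c e) \<doteq> (if a = c \<and> b = e then 2 else 0)) \<longleftrightarrow>
      (\<forall>b e. (\<Sum>k\<in>UNIV. E k b e) \<doteq> (if b = e then 2 else 0))"
    unfolding entry by (simp add: all_simps)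
  also have "\<dots> \<longleftrightarrow> (\<Sum>k\<in>UNIV. E k 1 2) \<doteq> 0 \<and> (\<Sum>k\<in>UNIV. E k 2 2) \<doteq> 2"
  proof (intro iffI conjI; (elim conjE)?)
    assume 12: "(\<Sum>k\<in>UNIV. E k 1 2) \<doteq> 0" and 22: "(\<Sum>k\<in>UNIV. E k 2 2) \<doteq> 2"
    have "(\<Sum>k\<in>UNIV. E k 2 1) \<doteq> (\<Sum>k\<in>UNIV. fstar (E k 1 2))"
      by (intro cong_sum cong_sym[OF matrix_unitsD(2)[OF E]])
    also have "\<dots> \<doteq> 0"
      using cong_star[OF 12] by (simp add: fstar_sum fstar_zero)
    finally have 21: "(\<Sum>k\<in>UNIV. E k 2 1) \<doteq> 0" .
    have "(\<Sum>k\<in>UNIV. E k 1 1) + (\<Sum>k\<in>UNIV. E k 2 2) = (\<Sum>k\<in>UNIV. \<Sum>a\<in>UNIV. E k a a)"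
      by (simp add: sum_2 sum.distrib)
    also have "\<dots> \<doteq> (\<Sum>k\<in>(UNIV :: 4 set). 1)"
      by (intro cong_sum matrix_units_unit E)
    also have "\<dots> = 2 + 2"
      by simp
    finally have "(\<Sum>k\<in>UNIV. E k 1 1) + (\<Sum>k\<in>UNIV. E k 2 2) \<doteq> 2 + 2" .
    from cong_diff[OF this 22] have "(\<Sum>k\<in>UNIV. E k 1 1) \<doteq> 2"
      by simp
    then show "\<forall>b e. (\<Sum>k\<in>UNIV. E k b e) \<doteq> (if b = e then 2 else 0)"
      using 12 21 22 by (simp add: forall_2)
  qed (simp_all add: forall_2)
  finally show ?thesis .
qed

text \<open>For \<open>k = l\<close> the matrix unit relations alone give \<open>2\<close>. For \<open>k \<noteq> l\<close>, left multiplication by the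
  projection \<open>E k 2 2\<close> cuts the sum of four terms down to the two terms with \<open>a = 2\<close>; conversely,
  multiplication by \<open>E k 1 2\<close> on the left and \<open>E l 2 1\<close> on the right carries these two terms to the
  other two.\<close>

lemma row_isometry_iff:
  assumes E: "\<And>k::4. matrix_units (E k :: 2 \<Rightarrow> 2 \<Rightarrow> 'g free)"
  shows "(\<forall>k l. (\<Sum>a\<in>UNIV. \<Sum>b\<in>UNIV. E k a b * fstar (E l a b)) \<doteq> (if k = l then 2 else 0)) \<longleftrightarrow>
    (\<forall>k l. k \<noteq> l \<longrightarrow> E k 2 1 * E l 1 2 + E k 2 2 * E l 2 2 \<doteq> 0)"
proof -
  define W where "W k l = (\<Sum>a\<in>UNIV. \<Sum>b\<in>UNIV. E k a b * E l b a)" for k l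
  have to_W: "(\<Sum>a\<in>UNIV. \<Sum>b\<in>UNIV. E k a b * fstar (E l a b)) \<doteq> W k l" for k l
    unfolding W_def by (intro cong_sum cong_mult cong_refl matrix_unitsD(2)[OF E])
  have diagonal: "W k k \<doteq> 2" for k
  proof -
    have "W k k \<doteq> (\<Sum>a\<in>UNIV. \<Sum>b\<in>(UNIV :: 2 set). E k a a)"
      unfolding W_def
    proof (intro cong_sum)
      show "E k a b * E k b a \<doteq> E k a a" for a b
        using matrix_unitsD(1)[OF E[of k], of a b b a] by simp
    qed
    also have "\<dots> = (\<Sum>a\<in>UNIV. E k a a) + (\<Sum>a\<in>UNIV. E k a a)"
      by (simp add: sum_2 mult_2 add_ac)
    also have "\<dots> \<doteq> 1 + 1"
      by (intro cong_add matrix_units_unit E)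
    finally show ?thesis by simp
  qed
  have off_diagonal: "W k l \<doteq> 0 \<longleftrightarrow> E k 2 1 * E l 1 2 + E k 2 2 * E l 2 2 \<doteq> 0" for k l
  proof
    note mult = matrix_unitsD(1)[OF E]
    have W: "W k l = E k 1 1 * E l 1 1 + E k 1 2 * E l 2 1 + (E k 2 1 * E l 1 2 + E k 2 2 * E l 2 2)"
      by (simp add: W_def sum_2)
    { assume "W k l \<doteq> 0"
      from cong_mult[OF cong_refl[of "E k 2 2"] this] have zero: "E k 2 2 * W k l \<doteq> 0"
        by simp
      have "E k 2 2 * W k l \<doteq> 0 * E l 1 1 + 0 * E l 2 1 + (E k 2 1 * E l 1 2 + E k 2 2 * E l 2 2)"
        unfolding W distrib_left mult.assoc[symmetric]
        using mult[of k 2 2 1 1] mult[of k 2 2 1 2] mult[of k 2 2 2 1] mult[of k 2 2 2 2]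
        by (intro cong_add cong_mult cong_refl) simp_all
      from cong_trans[OF cong_sym[OF this] zero]
      show "E k 2 1 * E l 1 2 + E k 2 2 * E l 2 2 \<doteq> 0"
        by simp }
    { assume lower: "E k 2 1 * E l 1 2 + E k 2 2 * E l 2 2 \<doteq> 0"
      have "E k 1 2 * (E k 2 1 * E l 1 2 + E k 2 2 * E l 2 2) * E l 2 1 =
          (E k 1 2 * E k 2 1) * (E l 1 2 * E l 2 1) + (E k 1 2 * E k 2 2) * (E l 2 2 * E l 2 1)"
        by (simp add: algebra_simps)
      also have "\<dots> \<doteq> E k 1 1 * E l 1 1 + E k 1 2 * E l 2 1"
        using mult[of k 1 2 2 1] mult[of l 1 2 2 1] mult[of k 1 2 2 2] mult[of l 2 2 2 1]
        by (intro cong_add cong_mult) simp_all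
      finally have "E k 1 1 * E l 1 1 + E k 1 2 * E l 2 1 \<doteq>
          E k 1 2 * (E k 2 1 * E l 1 2 + E k 2 2 * E l 2 2) * E l 2 1"
        by (rule cong_sym)
      also have "\<dots> \<doteq> E k 1 2 * 0 * E l 2 1"
        by (intro cong_mult cong_refl lower)
      finally have "E k 1 1 * E l 1 1 + E k 1 2 * E l 2 1 \<doteq> E k 1 2 * 0 * E l 2 1" .
      from cong_add[OF this lower] show "W k l \<doteq> 0"
        by (simp add: W) }
  qed
  have "(\<Sum>a\<in>UNIV. \<Sum>b\<in>UNIV. E k a b * fstar (E l a b)) \<doteq> (if k = l then 2 else 0) \<longleftrightarrow>
      (k \<noteq> l \<longrightarrow> E k 2 1 * E l 1 2 + E k 2 2 * E l 2 2 \<doteq> 0)" for k l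
    unfolding cong_cong[OF to_W cong_refl] off_diagonal[symmetric] using diagonal by simp
  then show ?thesis
    by simp
qed

text \<open>The unitary homomorphisms \<open>P\<close> correspond to the families of partial isometries that satisfy the
  relations of \<open>\<O>\<^sub>1\<close>: the matrix units are recovered from their entries at \<open>(1,2)\<close>.\<close>

lemma unitary_matrix_units_iff:
  "(\<forall>k. matrix_units (E k)) \<and> bi_unitary E \<longleftrightarrow>
    balanced_isometries (\<lambda>k. E k 1 2) \<and> (\<forall>k a b. E k a b \<doteq> units_of_isometry (E k 1 2) a b)"
proof (cases "\<forall>k. matrix_units (E k)")
  case True
  then have E: "matrix_units (E k)" for k by blast
  have half: "half_isometry (E k 1 2)" and units: "E k a b \<doteq> units_of_isometry (E k 1 2) a b" for k a b
    using E[of k] unfolding matrix_units_2_iff by blast+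
  have 21: "E k 2 1 \<doteq> fstar (E k 1 2)" and 22: "E k 2 2 \<doteq> fstar (E k 1 2) * E k 1 2" for k
    using units[of k 2 1] units[of k 2 2] by (simp_all add: units_of_isometry_def)
  have "(\<Sum>k\<in>UNIV. E k 2 2) \<doteq> 2 \<longleftrightarrow> (\<Sum>k\<in>UNIV. fstar (E k 1 2) * E k 1 2) \<doteq> 2"
    by (intro cong_cong cong_sum 22 cong_refl)
  moreover have "E k 2 1 * E l 1 2 + E k 2 2 * E l 2 2 \<doteq> 0 \<longleftrightarrow>
      fstar (E k 1 2) * E l 1 2 + fstar (E k 1 2) * E k 1 2 * fstar (E l 1 2) * E l 1 2 \<doteq> 0" for k l
    using cong_cong[OF cong_add[OF cong_mult[OF 21[of k] cong_refl[of "E l 1 2"]]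
        cong_mult[OF 22[of k] 22[of l]]] cong_refl[of 0]]
    by (simp add: mult.assoc)
  ultimately show ?thesis
    unfolding bi_unitary_def balanced_isometries_def column_isometry_iff[OF E] row_isometry_iff[OF E]
    using True half units by auto
next
  case False
  moreover have "\<forall>k. matrix_units (E k)"
    if "balanced_isometries (\<lambda>k. E k 1 2)" "\<forall>k a b. E k a b \<doteq> units_of_isometry (E k 1 2) a b"
    using that by (simp add: balanced_isometries_def matrix_units_2_iff)
  ultimately show ?thesis
    by blast
qed

lemma intertwiner_defect_1: "intertwiner_defect 1 E k c e = 0"
proof -
  have "(\<Sum>a\<in>UNIV. \<Sum>b\<in>UNIV. fscale (if a = c \<and> b = e then 1 else 0) (E k a b)) =
      (\<Sum>a\<in>UNIV. \<Sum>b\<in>UNIV. if b = e then (if a = c then E k a b else 0) else 0)"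
    by (intro sum.cong refl) (simp add: fscale_simps)
  moreover have "(\<Sum>l\<in>UNIV. fscale (if k = l then 1 else 0) (E l c e)) =
      (\<Sum>l\<in>UNIV. if k = l then E l c e else 0)"
    by (intro sum.cong refl) (simp add: fscale_simps)
  ultimately show ?thesis
    by (simp add: intertwiner_defect_def adjacency_entries del: One_nat_def)
qed

lemma intertwiner_defect_3:
  "intertwiner_defect 3 E k c e = intertwiner_defect 4 E k c e - intertwiner_defect 2 E k c e"
proof -
  have "fscale (u - v + w) x = fscale u x - fscale v x + fscale w x" for u v w and x :: "'g free"
    using fscale_simps(1)[of "u - v" v x] by (simp add: fscale_simps)
  then have "intertwiner_defect 3 E k c e =
      intertwiner_defect 4 E k c e - intertwiner_defect 2 E k c e + intertwiner_defect 1 E k c e"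
    unfolding intertwiner_defect_def adjacency_3
    by (simp add: sum.distrib sum_subtractf)
  then show ?thesis
    by (simp only: intertwiner_defect_1 add_0_right)
qed

text \<open>On both sides the fourth adjacency operator is \<open>x \<mapsto> 4 \<psi>(x) 1\<close> for the respective state \<open>\<psi>\<close>,
  and a unitary unital homomorphism preserves the states.\<close>

lemma intertwines_4:
  assumes E: "\<And>k. matrix_units (E k)" and "bi_unitary E"
  shows "intertwines 4 E"
proof -
  have sums: "(\<Sum>k\<in>UNIV. E k c e) \<doteq> (if c = e then 2 else 0)" for c e
  proof -
    \<comment> \<open>The factor \<open>E k c c\<close> makes the sum a scalar product of two columns of the unitary matrix.\<close>
    have "(\<Sum>k\<in>UNIV. E k c e) \<doteq> (\<Sum>k\<in>UNIV. fstar (E k c c) * E k c e)"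
    proof (rule cong_sum, rule cong_sym)
      fix k
      have "fstar (E k c c) * E k c e \<doteq> E k c c * E k c e"
        by (intro cong_mult matrix_unitsD(2)[OF E] cong_refl)
      also have "\<dots> \<doteq> E k c e"
        using matrix_unitsD(1)[OF E, of k c c c e] by simp
      finally show "fstar (E k c c) * E k c e \<doteq> E k c e" .
    qed
    also have "\<dots> \<doteq> (if c = e then 2 else 0)"
      using assms(2)[unfolded bi_unitary_def, THEN conjunct1, rule_format, of c c c e] by simp
    finally show ?thesis .
  qed
  have trace: "(\<Sum>a\<in>UNIV. \<Sum>b\<in>UNIV. fscale (if a = b \<and> c = e then 2 else 0) (E k a b)) \<doteq>
      (if c = e then 2 else 0)" for k c e
  proof -
    have "(\<Sum>a\<in>UNIV. \<Sum>b\<in>UNIV. fscale (if a = b \<and> c = e then 2 else 0) (E k a b)) =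
        fscale (if c = e then 2 else 0) (\<Sum>a\<in>UNIV. E k a a)"
      by (simp add: sum_2 fscale_simps)
    also have "\<dots> \<doteq> fscale (if c = e then 2 else 0) 1"
      by (intro cong_scale matrix_units_unit E)
    also have "\<dots> = (if c = e then 2 else 0)"
      by (simp add: fscale_2)
    finally show ?thesis .
  qed
  have "intertwiner_defect 4 E k c e \<doteq> 0" for k c e
    using cong_diff[OF trace[of c e k] sums[of c e]]
    by (simp add: intertwiner_defect_def adjacency_entries fscale_simps)
  then show ?thesis
    by (simp add: intertwines_def)
qed

text \<open>A diagonal unit is a product of two off-diagonal ones, in which the signs cancel.\<close>

lemma matrix_units_of_opposite_isometries:
  fixes E F :: "2 \<Rightarrow> 2 \<Rightarrow> 'g free"
  assumes E: "matrix_units E" and F: "matrix_units F" and opposite: "E 1 2 + F 1 2 \<doteq> 0"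
  shows "E 2 1 + F 2 1 \<doteq> 0" "E c c \<doteq> F c c"
proof -
  have 12: "F 1 2 \<doteq> - E 1 2"
    using cong_diff[OF opposite cong_refl[of "E 1 2"]] by simp
  have "F 2 1 \<doteq> fstar (F 1 2)"
    by (rule cong_sym[OF matrix_unitsD(2)[OF F]])
  also have "\<dots> \<doteq> fstar (- E 1 2)"
    by (rule cong_star[OF 12])
  also have "\<dots> = - fstar (E 1 2)"
    by (simp add: fstar_uminus)
  also have "\<dots> \<doteq> - E 2 1"
    by (intro cong_minus matrix_unitsD(2)[OF E])
  finally have 21: "F 2 1 \<doteq> - E 2 1" .
  show "E 2 1 + F 2 1 \<doteq> 0"
    using cong_add[OF cong_refl[of "E 2 1"] 21] by simp
  have factor: "F a b * F b a \<doteq> E a b * E b a" if "a \<noteq> b" for a b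
    using cong_mult[OF 12 21] cong_mult[OF 21 12] that exhaust_2[of a] exhaust_2[of b] by auto
  have "E c c \<doteq> F c c" if "c \<noteq> b" for b
  proof -
    have "E c c \<doteq> E c b * E b c"
      using cong_sym[OF matrix_unitsD(1)[OF E, of c b b c]] by simp
    also have "\<dots> \<doteq> F c b * F b c"
      by (rule cong_sym[OF factor[OF that]])
    also have "\<dots> \<doteq> F c c"
      using matrix_unitsD(1)[OF F, of c b b c] by simp
    finally show ?thesis .
  qed
  from this[of 1] this[of 2] show "E c c \<doteq> F c c"
    by fastforce
qed

lemma intertwiner_defect_2:
  "intertwiner_defect 2 E k c e =
    (if c = e then 2 * E k c c else 0) - (\<Sum>l\<in>UNIV. if same_pair k l then E l c e else 0)"
proof -
  have "(\<Sum>a\<in>UNIV. \<Sum>b\<in>UNIV. fscale (if a = b \<and> b = c \<and> c = e then 2 else 0) (E k a b)) =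
      (if c = e then fscale 2 (E k c c) else 0)"
    using exhaust_2[of c] by (auto simp: sum_2)
  then show ?thesis
    unfolding intertwiner_defect_def adjacency_entries
    by (simp add: fscale_2 fscale_simps if_distrib[of "\<lambda>z. fscale z _"] cong: if_cong)
qed

lemma same_pair_sum:
  "(\<Sum>l\<in>UNIV. if same_pair k l then f l else 0) = (if same_pair k 1 then f 1 + f 2 else f 3 + f 4)"
  for f :: "4 \<Rightarrow> 'g free"
  using exhaust_4[of k] by (auto simp: sum_4 same_pair_def)

text \<open>The second adjacency operator of \<open>M\<^sub>2\<close> kills the off-diagonal matrix units, whereas that of \<open>\<complex>\<^sup>4\<close>
  adds up the coordinates in each clique: this is where \<open>S\<^sub>1 + S\<^sub>2 = S\<^sub>3 + S\<^sub>4 = 0\<close> comes from. The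
  relations on the diagonal units then hold because the units of opposite isometries agree there.\<close>

lemma intertwines_2_iff:
  assumes E: "\<And>k. matrix_units (E k)"
  shows "intertwines 2 E \<longleftrightarrow> E 1 1 2 + E 2 1 2 \<doteq> 0 \<and> E 3 1 2 + E 4 1 2 \<doteq> 0"
proof
  assume "intertwines 2 E"
  then have "intertwiner_defect 2 E k 1 2 \<doteq> 0" for k
    by (simp add: intertwines_def)
  from cong_minus[OF this[of 1]] cong_minus[OF this[of 3]]
  show "E 1 1 2 + E 2 1 2 \<doteq> 0 \<and> E 3 1 2 + E 4 1 2 \<doteq> 0"
    by (simp add: intertwiner_defect_2 same_pair_sum) (simp add: same_pair_def)
next
  assume *: "E 1 1 2 + E 2 1 2 \<doteq> 0 \<and> E 3 1 2 + E 4 1 2 \<doteq> 0"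
  note opposite_12 = matrix_units_of_opposite_isometries[OF E E *[THEN conjunct1]]
  note opposite_34 = matrix_units_of_opposite_isometries[OF E E *[THEN conjunct2]]
  have double: "2 * x - (y + z) \<doteq> 0" if "x \<doteq> y" "x \<doteq> z" for x y z
    using cong_diff[OF cong_add[OF that] cong_refl[of "y + z"]] by (simp add: mult_2)
  have "intertwiner_defect 2 E k c e \<doteq> 0" for k c e
  proof (cases "c = e")
    case True
    have "intertwiner_defect 2 E k c c =
        2 * E k c c - (if k \<in> {1, 2} then E 1 c c + E 2 c c else E 3 c c + E 4 c c)"
      unfolding intertwiner_defect_2 same_pair_sum by (simp add: same_pair_def)
    moreover have "2 * E k c c -
        (if k \<in> {1, 2} then E 1 c c + E 2 c c else E 3 c c + E 4 c c) \<doteq> 0"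
      using exhaust_4[of k] opposite_12(2)[of c] opposite_34(2)[of c]
        cong_sym[OF opposite_12(2)[of c]] cong_sym[OF opposite_34(2)[of c]]
      by (elim disjE) (simp_all add: double)
    ultimately show ?thesis
      using True by simp
  next
    case False
    then have "c = 1 \<and> e = 2 \<or> c = 2 \<and> e = 1"
      using exhaust_2[of c] exhaust_2[of e] by auto
    then have "- (if same_pair k 1 then E 1 c e + E 2 c e else E 3 c e + E 4 c e) \<doteq> - 0"
      using * opposite_12(1) opposite_34(1) by (intro cong_minus) auto
    then show ?thesis
      using False by (simp add: intertwiner_defect_2 same_pair_sum)
  qed
  then show "intertwines 2 E"
    by (simp add: intertwines_def)
qed

lemma intertwines_iff:
  assumes E: "\<And>k. matrix_units (E k)" and U: "bi_unitary E" and d: "d \<in> {1, 2, 3, 4}"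
  shows "intertwines d E \<longleftrightarrow>
    (d \<in> {2, 3} \<longrightarrow> E 1 1 2 + E 2 1 2 \<doteq> 0 \<and> E 3 1 2 + E 4 1 2 \<doteq> 0)"
proof -
  have "intertwines 1 E"
    by (simp add: intertwines_def intertwiner_defect_1 del: One_nat_def)
  moreover have "intertwines 3 E \<longleftrightarrow> intertwines 2 E"
  proof -
    have "intertwiner_defect 4 E k c e \<doteq> 0" for k c e
      using intertwines_4[OF E U] by (simp add: intertwines_def)
    from cong_diff[OF this cong_refl]
    have "intertwiner_defect 3 E k c e \<doteq> - intertwiner_defect 2 E k c e" for k c e
      by (simp add: intertwiner_defect_3)
    from cong_cong[OF this cong_refl]
    have "intertwiner_defect 3 E k c e \<doteq> 0 \<longleftrightarrow> - intertwiner_defect 2 E k c e \<doteq> 0" for k c e .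
    moreover have "- x \<doteq> 0 \<longleftrightarrow> x \<doteq> 0" for x
      using cong_minus[of x 0] cong_minus[of "- x" 0] by auto
    ultimately show ?thesis
      by (simp add: intertwines_def)
  qed
  ultimately show ?thesis
    using d intertwines_4[OF E U] intertwines_2_iff[OF E] by auto
qed

end


section \<open>The coordinates of the quantum isomorphism\<close>

lemma sum_M2_index: "(\<Sum>i\<in>UNIV. f i) = (\<Sum>a\<in>UNIV. \<Sum>b\<in>UNIV. f (M2_index a b))"
  for f :: "4 \<Rightarrow> 'a::comm_monoid_add"
  by (simp add: sum_4 sum_2 M2_index_def add.assoc)

lemma all_M2_index: "(\<forall>i. P i) \<longleftrightarrow> (\<forall>a b. P (M2_index a b))"
  by (auto simp: forall_4 forall_2 M2_index_def)

lemma M2_index_eq_iff: "M2_index a b = M2_index c e \<longleftrightarrow> a = c \<and> b = e"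
proof -
  have "\<forall>a b c e. M2_index a b = M2_index c e \<longleftrightarrow> a = c \<and> b = e"
    by (simp add: forall_2 M2_index_def)
  then show ?thesis by blast
qed

lemma M2_basis_index: "M2_basis (M2_index a b) = msmult (complex_of_real (sqrt 2)) (matrix_unit a b)"
proof -
  have "\<forall>a b. M2_basis (M2_index a b) = msmult (complex_of_real (sqrt 2)) (matrix_unit a b)"
    by (simp add: forall_2 M2_basis_def M2_index_def vector_4)
  then show ?thesis by blast
qed

lemma M2_coordinate:
  "M2_state (mstar cnj (M2_basis (M2_index a b)) ** x) = complex_of_real (sqrt 2) / 2 * x $ a $ b"
proof -
  have "(mstar cnj (M2_basis (M2_index a b)) ** x) $ p $ p =
      (\<Sum>k\<in>UNIV. if k = a then (if p = b then complex_of_real (sqrt 2) * x $ a $ b else 0) else 0)" for p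
    unfolding matrix_matrix_mult_def vec_lambda_beta
    by (intro sum.cong refl) (auto simp: mstar_def M2_basis_index msmult_def matrix_unit_def)
  then show ?thesis
    by (simp add: M2_state_def trace_def)
qed

lemma sqrt_2_sqrt_2: "complex_of_real (sqrt 2) * complex_of_real (sqrt 2) = 2"
  by (simp flip: of_real_mult)

lemma M2_adjacency_entry:
  "qadj (M2_graph d) x $ a $ b =
    (\<Sum>c\<in>UNIV. \<Sum>e\<in>UNIV. M2_adj d $ M2_index a b $ M2_index c e * x $ c $ e)"
proof -
  have entry: "msmult (u * M2_state (mstar cnj (M2_basis (M2_index c e)) ** x)) (M2_basis (M2_index i j)) $ a $ b =
      (if j = b then (if i = a then u * x $ c $ e else 0) else 0)" for u c e i j
  proof -
    have "u * (complex_of_real (sqrt 2) / 2 * y) * complex_of_real (sqrt 2) = u * y" for y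
      using sqrt_2_sqrt_2 by simp
    then show ?thesis
      unfolding M2_coordinate unfolding M2_basis_index by (simp add: msmult_def matrix_unit_def)
  qed
  have "qadj (M2_graph d) x $ a $ b = (\<Sum>i\<in>UNIV. \<Sum>j\<in>UNIV. if j = b then (if i = a then
      (\<Sum>c\<in>UNIV. \<Sum>e\<in>UNIV. M2_adj d $ M2_index i j $ M2_index c e * x $ c $ e) else 0) else 0)"
    unfolding M2_graph_def quantum_graph.simps sum_M2_index sum_component entry
    by (intro sum.cong refl) auto
  then show ?thesis
    by simp
qed

text \<open>The generator \<open>P\<^sub>i\<^sup>k\<close>, rescaled and indexed by a pair: \<open>coefficient k a b\<close> is the value on the
  matrix unit \<open>e\<^sub>a\<^sub>b\<close> of the \<open>k\<close>-th coordinate \<open>M\<^sub>2 \<rightarrow> O\<close> of \<open>P\<close>.\<close>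

definition coefficient :: "4 \<Rightarrow> 2 \<Rightarrow> 2 \<Rightarrow> (4 \<times> 4) free"
  where "coefficient k a b = fscale (complex_of_real (sqrt 2)) (gen (M2_index a b, k))"

lemma amplified_component:
  "amplified T C4_basis (M2_graph d) M2_basis x $ p $ q =
    (\<Sum>k\<in>UNIV. fscale (T (C4_basis k) $ p $ q / 2) (linear_extension (coefficient k) x))"
proof -
  have inner: "qinner (M2_graph d) (M2_basis (M2_index a b)) x = complex_of_real (sqrt 2) / 2 * x $ a $ b"
    for a b
    by (simp add: qinner_def M2_graph_def M2_coordinate)
  have "amplified T C4_basis (M2_graph d) M2_basis x $ p $ q = (\<Sum>i\<in>UNIV. \<Sum>k\<in>UNIV.
      fscale (T (C4_basis k) $ p $ q) (fscale (qinner (M2_graph d) (M2_basis i) x) (gen (i, k))))"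
    by (simp add: amplified_def free_tensor_def)
  also have "\<dots> = (\<Sum>k\<in>UNIV. \<Sum>i\<in>UNIV.
      fscale (T (C4_basis k) $ p $ q) (fscale (qinner (M2_graph d) (M2_basis i) x) (gen (i, k))))"
    by (rule sum.swap)
  also have "\<dots> = (\<Sum>k\<in>UNIV. fscale (T (C4_basis k) $ p $ q / 2) (linear_extension (coefficient k) x))"
    unfolding sum_M2_index inner linear_extension_def coefficient_def fscale_sum
    by (intro sum.cong refl) (simp add: fscale_simps mult_ac)
  finally show ?thesis .
qed

lemma formal_map_component:
  "formal_map C4_basis (M2_graph d) M2_basis x $ p $ q =
    (if p = q then linear_extension (coefficient p) x else 0)"
proof -
  have "formal_map C4_basis (M2_graph d) M2_basis x $ p $ q =
      (\<Sum>k\<in>UNIV. if p = k then (if p = q then linear_extension (coefficient p) x else 0) else 0)"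
    unfolding formal_map_def amplified_component
    by (intro sum.cong refl) (auto simp: C4_basis_def msmult_def matrix_unit_def fscale_simps)
  then show ?thesis
    by simp
qed

lemma amplified_adjacency_component:
  "amplified (qadj (C4_graph d')) C4_basis (M2_graph d) M2_basis x $ p $ q =
    (if p = q then \<Sum>l\<in>UNIV. fscale (C4_adj d' $ p $ l) (linear_extension (coefficient l) x) else 0)"
proof -
  have "qadj (C4_graph d') (C4_basis k) $ p $ q = (if p = q then 2 * C4_adj d' $ p $ k else 0)" for k
  proof -
    have "qadj (C4_graph d') (C4_basis k) $ p $ q =
        (\<Sum>r\<in>UNIV. \<Sum>s\<in>UNIV. if k = s then (if p = r then (if p = q then 2 * C4_adj d' $ p $ k else 0) else 0) else 0)"
      unfolding C4_graph_def quantum_graph.simps sum_component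
      by (intro sum.cong refl) (auto simp: C4_basis_def msmult_def matrix_unit_def)
    then show ?thesis
      by simp
  qed
  then show ?thesis
    by (simp add: amplified_component)
qed

lemma entries_subset_iff: "entries M \<subseteq> J \<longleftrightarrow> (\<forall>p q. M $ p $ q \<in> J)"
  by (auto simp: entries_def)

lemma diagonal_matrix_product:
  fixes M N :: "'g free^4^4"
  assumes "\<And>p q. M $ p $ q = (if p = q then m p else 0)" "\<And>p q. N $ p $ q = (if p = q then n p else 0)"
  shows "(M ** N) $ p $ q = (if p = q then m p * n p else 0)"
proof -
  have "(M ** N) $ p $ q = (\<Sum>k\<in>UNIV. if p = k then (if p = q then m p * n p else 0) else 0)"
    unfolding matrix_matrix_mult_def vec_lambda_beta by (intro sum.cong refl) (auto simp: assms)
  then show ?thesis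
    by simp
qed

lemma (in free_star_ideal) scale_mem_iff: "c \<noteq> 0 \<Longrightarrow> fscale c x \<in> J \<longleftrightarrow> x \<in> J"
  using scale_mem[of x c] scale_mem[of "fscale c x" "inverse c"] by (auto simp: fscale_simps)

text \<open>The matrices in the relations are diagonal, so that each matrix relation splits into one relation
  for every coordinate \<open>k\<close>. The unitarity relations are multiplied by \<open>2\<close>, which is invertible, to
  pass from the \<open>P\<^sub>i\<^sup>k\<close> to the values on the matrix units.\<close>

lemma bigalois_relations_subset_iff:
  assumes J: "free_star_ideal J"
  shows "bigalois_relations (C4_graph d) C4_basis (M2_graph d) M2_basis \<subseteq> J \<longleftrightarrow>
    (\<forall>k. free_star_ideal.matrix_units J (coefficient k)) \<and>
    free_star_ideal.bi_unitary J coefficient \<and> free_star_ideal.intertwines J d coefficient"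
proof -
  interpret free_star_ideal J by fact
  let ?P = "formal_map C4_basis (M2_graph d) M2_basis"
  let ?\<rho> = "\<lambda>k. linear_extension (coefficient k)"
  let ?U = "coefficient_matrix :: ((4 \<times> 4) free)^4^4"
  have mult: "(\<forall>p q. (?P (x ** y) - ?P x ** ?P y) $ p $ q \<in> J) \<longleftrightarrow>
      (\<forall>k. ?\<rho> k (x ** y) \<doteq> ?\<rho> k x * ?\<rho> k y)" for x y
    unfolding vector_minus_component
      diagonal_matrix_product[OF formal_map_component formal_map_component]
    by (simp add: formal_map_component cong_mod_def zero_mem)
  have one: "(\<forall>p q. (?P (mat 1) - mat 1) $ p $ q \<in> J) \<longleftrightarrow> (\<forall>k. ?\<rho> k (mat 1) \<doteq> 1)"
    unfolding vector_minus_component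
    by (simp add: formal_map_component mat_def cong_mod_def zero_mem)
  have star: "(\<forall>p q. (?P (mstar cnj x) - mstar fstar (?P x)) $ p $ q \<in> J) \<longleftrightarrow>
      (\<forall>k. ?\<rho> k (mstar cnj x) \<doteq> fstar (?\<rho> k x))" for x
    unfolding vector_minus_component
    by (simp add: formal_map_component mstar_def[of fstar] cong_mod_def zero_mem fstar_zero)
  have adjacency: "(\<forall>p q. (?P (qadj (M2_graph d) x) -
        amplified (qadj (C4_graph d)) C4_basis (M2_graph d) M2_basis x) $ p $ q \<in> J) \<longleftrightarrow>
      (\<forall>k. ?\<rho> k (qadj (M2_graph d) x) \<doteq> (\<Sum>l\<in>UNIV. fscale (C4_adj d $ k $ l) (?\<rho> l x)))" for x
    unfolding vector_minus_component
    by (simp add: formal_map_component amplified_adjacency_component cong_mod_def zero_mem)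
  have scaled: "fscale 2 (x - (if b then 1 else 0)) = fscale 2 x - (if b then 2 else 0)"
    for x :: "(4 \<times> 4) free" and b
    by (simp add: fscale_2 right_diff_distrib)
  have "fscale 2 (fstar (gen (i, k)) * gen (j, k)) =
      fstar (fscale (complex_of_real (sqrt 2)) (gen (i, k))) * fscale (complex_of_real (sqrt 2)) (gen (j, k))"
    "fscale 2 (gen (i, k) * fstar (gen (i, l))) =
      fscale (complex_of_real (sqrt 2)) (gen (i, k)) * fstar (fscale (complex_of_real (sqrt 2)) (gen (i, l)))"
    for i j k l :: 4
    by (simp_all add: fstar_fscale fscale_mult_right fscale_simps sqrt_2_sqrt_2)
  then have column: "fscale 2 ((mstar fstar ?U ** ?U) $ M2_index a b $ M2_index c e) =
      (\<Sum>k\<in>UNIV. fstar (coefficient k a b) * coefficient k c e)"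
    and row: "fscale 2 ((?U ** mstar fstar ?U) $ k $ l) =
      (\<Sum>a\<in>UNIV. \<Sum>b\<in>UNIV. coefficient k a b * fstar (coefficient l a b))" for a b c e k l
    by (simp_all add: matrix_matrix_mult_def mstar_def coefficient_matrix_def fscale_sum
        sum_M2_index coefficient_def)
  have column_iff: "(\<forall>p q. (mstar fstar ?U ** ?U - mat 1) $ p $ q \<in> J) \<longleftrightarrow>
      (\<forall>a b c e. (\<Sum>k\<in>UNIV. fstar (coefficient k a b) * coefficient k c e) \<doteq>
        (if a = c \<and> b = e then 2 else 0))"
    unfolding all_M2_index vector_minus_component mat_def vec_lambda_beta M2_index_eq_iff cong_mod_def
      column[symmetric] scaled[symmetric] by (simp add: scale_mem_iff)
  have row_iff: "(\<forall>p q. (?U ** mstar fstar ?U - mat 1) $ p $ q \<in> J) \<longleftrightarrow>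
      (\<forall>k l. (\<Sum>a\<in>UNIV. \<Sum>b\<in>UNIV. coefficient k a b * fstar (coefficient l a b)) \<doteq>
        (if k = l then 2 else 0))"
    unfolding vector_minus_component mat_def vec_lambda_beta cong_mod_def
      row[symmetric] scaled[symmetric] by (simp add: scale_mem_iff)
  have intertwiner: "(\<forall>x k. ?\<rho> k (qadj (M2_graph d) x) \<doteq>
      (\<Sum>l\<in>UNIV. fscale (C4_adj d $ k $ l) (?\<rho> l x))) \<longleftrightarrow> intertwines d coefficient"
  proof -
    let ?F = "\<lambda>k c e. \<Sum>a\<in>UNIV. \<Sum>b\<in>UNIV. fscale (M2_adj d $ M2_index a b $ M2_index c e) (coefficient k a b)"
    let ?G = "\<lambda>k c e. \<Sum>l\<in>UNIV. fscale (C4_adj d $ k $ l) (coefficient l c e)"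
    have "?\<rho> k (qadj (M2_graph d) x) = linear_extension (?F k) x" for k x
      unfolding linear_extension_def M2_adjacency_entry
      by (simp add: sum_2 fscale_simps algebra_simps)
    moreover have "(\<Sum>l\<in>UNIV. fscale (C4_adj d $ k $ l) (?\<rho> l x)) = linear_extension (?G k) x" for k x
      by (simp add: linear_extension_def sum_2 sum_4 fscale_simps algebra_simps)
    moreover have "(\<forall>x k. linear_extension (?F k) x \<doteq> linear_extension (?G k) x) \<longleftrightarrow>
        (\<forall>k c e. ?F k c e \<doteq> ?G k c e)"
      by (subst all_comm) (simp only: linear_extension_cong_iff)
    ultimately show ?thesis
      by (simp add: intertwines_def intertwiner_defect_def cong_mod_def)
  qed
  have "bigalois_relations (C4_graph d) C4_basis (M2_graph d) M2_basis \<subseteq> J \<longleftrightarrow>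
      (\<forall>x y k. ?\<rho> k (x ** y) \<doteq> ?\<rho> k x * ?\<rho> k y) \<and> (\<forall>k. ?\<rho> k (mat 1) \<doteq> 1) \<and>
      (\<forall>x k. ?\<rho> k (mstar cnj x) \<doteq> fstar (?\<rho> k x)) \<and> intertwines d coefficient \<and>
      bi_unitary coefficient"
    unfolding bigalois_relations_def Let_def Un_subset_iff UN_subset_iff entries_subset_iff
      mult one star adjacency column_iff row_iff bi_unitary_def intertwiner[symmetric]
    by (simp add: M2_graph_def)
  then show ?thesis
    unfolding matrix_units_iff by auto
qed


section \<open>Presentations by partial isometries\<close>

abbreviation bigO_relations :: "nat \<Rightarrow> (4 \<times> 4) free set"
  where "bigO_relations d \<equiv> bigalois_relations (C4_graph d) C4_basis (M2_graph d) M2_basis"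

abbreviation S_generator :: "4 \<Rightarrow> (4 \<times> 4) free"
  where "S_generator k \<equiv> coefficient k 1 2"

text \<open>Modulo the relations of \<open>\<O>\<^sub>d\<close> all \<open>P\<^sub>i\<^sup>k\<close> are expressed through the \<open>S\<^sub>k\<close>, and
  the \<open>S\<^sub>k\<close> satisfy the relations of \<open>\<O>\<^sub>1\<close>, to which \<open>d = 2, 3\<close> add the two relations between
  opposite isometries.\<close>

lemma bigO_relations_iff:
  assumes J: "free_star_ideal J" and d: "d \<in> {1, 2, 3, 4}"
  shows "bigO_relations d \<subseteq> J \<longleftrightarrow>
    free_star_ideal.balanced_isometries J S_generator \<and>
    (\<forall>k a b. cong_mod J (coefficient k a b) (units_of_isometry (S_generator k) a b)) \<and>
    (d \<in> {2, 3} \<longrightarrow> S_generator 1 + S_generator 2 \<in> J \<and> S_generator 3 + S_generator 4 \<in> J)"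
proof -
  interpret free_star_ideal J by fact
  show ?thesis
    unfolding bigalois_relations_subset_iff[OF J] mem_iff_cong_zero
    using unitary_matrix_units_iff[of coefficient] intertwines_iff[OF _ _ d, of coefficient]
    by blast
qed

lemma bigO_ideal_1_4: "free_ideal (bigO_relations 1) = free_ideal (bigO_relations 4)"
  by (rule free_ideal_eqI) (simp add: bigO_relations_iff del: One_nat_def)

lemma bigO_ideal_2_3: "free_ideal (bigO_relations 2) = free_ideal (bigO_relations 3)"
  by (rule free_ideal_eqI) (simp add: bigO_relations_iff)

lemma bigO_ideal_2:
  "free_ideal (bigO_relations 1 \<union> {S_generator 1 + S_generator 2, S_generator 3 + S_generator 4}) =
    free_ideal (bigO_relations 2)"
  by (rule free_ideal_eqI) (auto simp: bigO_relations_iff simp del: One_nat_def)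

lemma subst_2 [simp]: "subst f 2 = 2"
  using subst_add[of f 1 1] by simp

lemma subst_relations_14_iff:
  assumes "free_star_ideal J"
  shows "subst s ` relations_14 \<subseteq> J \<longleftrightarrow> free_star_ideal.balanced_isometries J s"
proof -
  interpret free_star_ideal J by fact
  have pairs: "subst s ` {F q r | r q. r \<noteq> q} \<subseteq> J \<longleftrightarrow> (\<forall>q r. q \<noteq> r \<longrightarrow> subst s (F q r) \<in> J)" for F
  proof -
    have "{F q r | r q. r \<noteq> q} = (\<Union>q. \<Union>r\<in>{r. q \<noteq> r}. {F q r})"
      by auto metis
    then show ?thesis
      by (simp add: image_UN UN_subset_iff)
  qed
  show ?thesis
    unfolding relations_14_def partial_isometry_relations_def balanced_isometries_def half_isometry_def
      image_Un Un_subset_iff pairs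
    by (simp add: image_UN UN_subset_iff subst_simps cong_mod_def)
qed

lemma subst_relations_23_iff:
  assumes "free_star_ideal J"
  shows "subst s ` relations_23 \<subseteq> J \<longleftrightarrow>
    free_star_ideal.half_isometry J (s 1) \<and> free_star_ideal.half_isometry J (s 2) \<and>
    cong_mod J (fstar (s 1) * s 1 + fstar (s 2) * s 2) 1"
proof -
  interpret free_star_ideal J by fact
  show ?thesis
    unfolding relations_23_def partial_isometry_relations_def half_isometry_def UNIV_2
    by (simp add: image_Un subst_simps cong_mod_def conj_ac)
qed

lemma balanced_isometries_vimage:
  assumes "free_star_ideal J"
  shows "free_star_ideal.balanced_isometries (subst h -` J) s \<longleftrightarrow>
    free_star_ideal.balanced_isometries J (\<lambda>k. subst h (s k))"
proof -
  interpret free_star_ideal J by fact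
  interpret V: free_star_ideal "subst h -` J"
    by (rule free_star_ideal_vimage) fact
  show ?thesis
    unfolding balanced_isometries_def V.balanced_isometries_def half_isometry_def V.half_isometry_def
    by (simp add: cong_mod_vimage subst_simps)
qed

definition signed_pair :: "'g free \<Rightarrow> 'g free \<Rightarrow> 4 \<Rightarrow> 'g free"
  where "signed_pair x y k = (if k = 1 then x else if k = 2 then - x else if k = 3 then y else - y)"

context free_star_ideal
begin

text \<open>Here \<open>y\<^sup>* y = x x\<^sup>*\<close>, both being the complement of \<open>x\<^sup>* x\<close>. Hence
  \<open>x\<^sup>* y = x\<^sup>* (x x\<^sup>*) y = x\<^sup>* y\<^sup>* y y = 0\<close>, while the supports of \<open>x\<close> and \<open>y\<close> are orthogonal, so both
  terms of every mixed relation vanish. The relations between \<open>x\<close> and \<open>-x\<close> say that \<open>x\<^sup>* x\<close> is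
  idempotent.\<close>

lemma balanced_signed_pair:
  assumes x: "half_isometry x" and y: "half_isometry y" and sum: "fstar x * x + fstar y * y \<doteq> 1"
  shows "balanced_isometries (signed_pair x y)"
proof -
  have orth: "fstar u * v \<doteq> 0 \<and> fstar u * u * fstar v * v \<doteq> 0"
    if u: "half_isometry u" and v: "half_isometry v" and uv: "fstar u * u + fstar v * v \<doteq> 1" for u v
  proof -
    have vv: "v * v \<doteq> 0"
      by (rule half_isometry_square[OF v])
    have uu: "fstar u * u * fstar u \<doteq> fstar u" "u * fstar u + fstar u * u \<doteq> 1"
      using u cong_star[of "u * fstar u * u" u] by (simp_all add: half_isometry_def fstar_mult fstar_fstar mult.assoc)
    have v_star: "fstar v * v \<doteq> u * fstar u"
      using cong_diff[OF cong_trans[OF uv cong_sym[OF uu(2)]] cong_refl[of "fstar u * u"]] by simp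
    have "fstar u * v \<doteq> fstar u * u * fstar u * v"
      by (intro cong_mult cong_refl cong_sym[OF uu(1)])
    also have "\<dots> = fstar u * (u * fstar u) * v"
      by (simp add: mult.assoc)
    also have "\<dots> \<doteq> fstar u * (fstar v * v) * v"
      by (intro cong_mult cong_refl cong_sym[OF v_star])
    also have "\<dots> = fstar u * fstar v * (v * v)"
      by (simp add: mult.assoc)
    also have "\<dots> \<doteq> fstar u * fstar v * 0"
      by (intro cong_mult cong_refl vv)
    finally have "fstar u * v \<doteq> 0" by simp
    have "fstar u * u * fstar v * v = fstar u * u * (fstar v * v)"
      by (simp add: mult.assoc)
    also have "\<dots> \<doteq> fstar u * u * (u * fstar u)"
      by (intro cong_mult cong_refl v_star)
    also have "\<dots> = fstar u * (u * u) * fstar u"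
      by (simp add: mult.assoc)
    also have "\<dots> \<doteq> fstar u * 0 * fstar u"
      by (intro cong_mult cong_refl half_isometry_square[OF u])
    finally show ?thesis
      using \<open>fstar u * v \<doteq> 0\<close> by simp
  qed
  have xx: "fstar x * x * fstar x * x \<doteq> fstar x * x"
    and yy: "fstar y * y * fstar y * y \<doteq> fstar y * y"
    using x y cong_mult[OF cong_refl[of "fstar x"], of "x * fstar x * x" x]
      cong_mult[OF cong_refl[of "fstar y"], of "y * fstar y * y" y]
    by (simp_all add: half_isometry_def mult.assoc)
  have neg: "half_isometry (- u) \<longleftrightarrow> half_isometry u" for u
    using cong_minus[of "u * fstar u * u" u] cong_minus[of "- (u * fstar u * u)" "- u"]
    by (auto simp: half_isometry_def fstar_uminus)
  have xy: "fstar x * y \<doteq> 0" "fstar x * x * fstar y * y \<doteq> 0"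
    using orth[OF x y sum] by auto
  have yx: "fstar y * x \<doteq> 0" "fstar y * y * fstar x * x \<doteq> 0"
    using orth[OF y x] sum by (auto simp: add.commute)
  have zero: "u + v \<doteq> 0" "v - u \<doteq> 0" if "u \<doteq> 0" "v \<doteq> 0" for u v
    using cong_add[OF that] cong_diff[OF that(2,1)] by simp_all
  have cancel: "v - u \<doteq> 0" if "v \<doteq> u" for u v
    using cong_diff[OF that cong_refl[of u]] by simp
  have supports: "(\<Sum>r\<in>UNIV. fstar (signed_pair x y r) * signed_pair x y r) \<doteq> 2"
    using cong_add[OF sum sum] by (simp add: sum_4 signed_pair_def fstar_uminus algebra_simps)
  have "half_isometry (signed_pair x y r)" for r
    using x y by (simp add: signed_pair_def neg)
  moreover have "(\<Sum>r\<in>UNIV. signed_pair x y r) \<doteq> 0"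
    by (simp add: sum_4 signed_pair_def)
  moreover have "fstar (signed_pair x y q) * signed_pair x y r +
      fstar (signed_pair x y q) * signed_pair x y q * fstar (signed_pair x y r) * signed_pair x y r \<doteq> 0"
    if "q \<noteq> r" for q r
    using exhaust_4[of q] exhaust_4[of r] that
    by (elim disjE)
      (simp_all add: signed_pair_def fstar_uminus zero[OF xy] zero[OF yx] cancel[OF xx] cancel[OF yy])
  ultimately show ?thesis
    using supports by (simp add: balanced_isometries_def)
qed

end

text \<open>The coefficients \<open>P\<^sub>i\<^sup>k\<close> of the map \<open>P\<close> built from the partial isometries \<open>S\<^sub>k = s k\<close>.\<close>

definition isometry_coefficients :: "(4 \<Rightarrow> 'g free) \<Rightarrow> 4 \<times> 4 \<Rightarrow> 'g free"
  where "isometry_coefficients s = (\<lambda>(i, k). fscale (1 / complex_of_real (sqrt 2))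
    (if i = 1 then s k * fstar (s k) else if i = 2 then s k
     else if i = 3 then fstar (s k) else fstar (s k) * s k))"

lemma isometry_coefficients_index:
  "isometry_coefficients s (M2_index a b, k) =
    fscale (1 / complex_of_real (sqrt 2)) (units_of_isometry (s k) a b)"
  by (simp add: isometry_coefficients_def M2_index_def units_of_isometry_def)

lemma subst_isometry_coefficients:
  "subst (isometry_coefficients s) (coefficient k a b) = units_of_isometry (s k) a b"
  by (simp add: coefficient_def subst_fscale isometry_coefficients_index fscale_simps)

lemma subst_units_of_isometry:
  "subst f (units_of_isometry s a b) = units_of_isometry (subst f s) a b"
  by (simp add: units_of_isometry_def subst_simps)

lemma (in free_star_ideal) units_of_isometry_cong:
  "s \<doteq> s' \<Longrightarrow> units_of_isometry s a b \<doteq> units_of_isometry s' a b"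
  by (simp add: units_of_isometry_def cong_mult cong_star)

text \<open>The generators \<open>g\<close> stand for those \<open>S\<^sub>k\<close> with \<open>k = index g\<close>, and \<open>s\<close> expresses all four \<open>S\<^sub>k\<close>
  through them. That \<open>isometry_coefficients s\<close> respects the relations of \<open>\<O>\<^sub>d\<close> follows from
  \<open>bigO_relations_iff\<close> for the preimage of the ideal generated by \<open>R\<close>.\<close>

lemma bigO_presentation:
  fixes R :: "'g free set" and s :: "4 \<Rightarrow> 'g free" and index :: "'g \<Rightarrow> 4"
  assumes d: "d \<in> {1, 2, 3, 4}"
    and index: "\<And>g. s (index g) = gen g"
    and balanced: "free_star_ideal.balanced_isometries (free_ideal R) s"
    and opposite: "d \<in> {2, 3} \<Longrightarrow> s 1 + s 2 \<in> free_ideal R \<and> s 3 + s 4 \<in> free_ideal R"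
    and relations: "subst (\<lambda>g. S_generator (index g)) ` R \<subseteq> free_ideal (bigO_relations d)"
    and images: "\<And>k. cong_mod (free_ideal (bigO_relations d))
      (subst (\<lambda>g. S_generator (index g)) (s k)) (S_generator k)"
  shows "\<exists>\<phi>\<in>star_iso (presented R) (bigO d).
    \<forall>x. \<phi> (presented_class R x) =
      presented_class (bigO_relations d) (subst (\<lambda>g. S_generator (index g)) x)"
  unfolding bigO_def bigalois_def
proof (rule presented_iso[OF relations, of "isometry_coefficients s"])
  let ?h = "isometry_coefficients s"
  interpret J: free_star_ideal "free_ideal R" by (rule free_star_ideal_generated)
  interpret J': free_star_ideal "free_ideal (bigO_relations d)" by (rule free_star_ideal_generated)
  have S: "subst ?h (S_generator k) = s k" for k
    by (simp add: subst_isometry_coefficients units_of_isometry_def)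
  have coefficients: "J.congr (subst ?h (coefficient k a b)) (units_of_isometry (s k) a b)" for k a b
    by (simp add: subst_isometry_coefficients)
  have "bigO_relations d \<subseteq> subst ?h -` free_ideal R"
    unfolding bigO_relations_iff[OF free_star_ideal_vimage[OF J.free_star_ideal_axioms] d]
      balanced_isometries_vimage[OF J.free_star_ideal_axioms] cong_mod_vimage S subst_units_of_isometry
    using balanced opposite coefficients by (simp add: subst_add S)
  then show "subst ?h ` bigO_relations d \<subseteq> free_ideal R"
    by blast
  show "cong_mod (free_ideal R) (subst ?h (S_generator (index g))) (gen g)" for g
    by (simp add: S index)
  have "cong_mod (free_ideal (bigO_relations d))
      (subst (\<lambda>g. S_generator (index g)) (?h (M2_index a b, k))) (gen (M2_index a b, k))" for a b k
  proof -
    have "subst (\<lambda>g. S_generator (index g)) (?h (M2_index a b, k)) =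
        fscale (1 / complex_of_real (sqrt 2))
          (units_of_isometry (subst (\<lambda>g. S_generator (index g)) (s k)) a b)"
      by (simp add: isometry_coefficients_index subst_fscale subst_units_of_isometry)
    also have "J'.congr \<dots> (fscale (1 / complex_of_real (sqrt 2)) (units_of_isometry (S_generator k) a b))"
      by (intro J'.cong_scale J'.units_of_isometry_cong images)
    also have "J'.congr \<dots> (fscale (1 / complex_of_real (sqrt 2)) (coefficient k a b))"
      using bigO_relations_iff[OF J'.free_star_ideal_axioms d] free_ideal_generators
      by (intro J'.cong_scale J'.cong_sym[of "coefficient k a b"]) blast
    also have "\<dots> = gen (M2_index a b, k)"
      by (simp add: coefficient_def fscale_simps)
    finally show ?thesis .
  qed
  then show "cong_mod (free_ideal (bigO_relations d))
      (subst (\<lambda>g. S_generator (index g)) (?h p)) (gen p)" for p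
    using all_M2_index[of "\<lambda>i. cong_mod (free_ideal (bigO_relations d))
      (subst (\<lambda>g. S_generator (index g)) (?h (i, snd p))) (gen (i, snd p))"]
    by (cases p) simp
qed

lemma bigO_1_universal:
  "is_universal_star_algebra (bigO 1) (\<lambda>r. presented_class (bigO_relations 1) (S_generator r)) relations_14"
proof -
  interpret J: free_star_ideal "free_ideal relations_14" by (rule free_star_ideal_generated)
  interpret J': free_star_ideal "free_ideal (bigO_relations 1)" by (rule free_star_ideal_generated)
  have "J.balanced_isometries gen"
    using subst_relations_14_iff[OF J.free_star_ideal_axioms, of gen] free_ideal_generators[of relations_14]
    by (simp add: subst_gen_id)
  moreover have "J'.balanced_isometries S_generator"
    using bigO_relations_iff[OF J'.free_star_ideal_axioms, of 1] free_ideal_generators[of "bigO_relations 1"]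
    by (simp del: One_nat_def)
  then have "subst S_generator ` relations_14 \<subseteq> free_ideal (bigO_relations 1)"
    by (simp add: subst_relations_14_iff[OF J'.free_star_ideal_axioms] del: One_nat_def)
  ultimately obtain \<phi> where \<phi>: "\<phi> \<in> star_iso (presented relations_14) (bigO 1)"
    "\<And>x. \<phi> (presented_class relations_14 x) = presented_class (bigO_relations 1) (subst S_generator x)"
    using bigO_presentation[of 1 gen "\<lambda>g. g" relations_14] by (auto simp del: One_nat_def)
  then show ?thesis
    unfolding is_universal_star_algebra_def by (intro bexI[OF _ \<phi>(1)]) (simp del: One_nat_def)
qed

text \<open>In the converse direction the sum relation of \<open>\<O>\<^sub>1\<close> reads \<open>2 (S\<^sub>1\<^sup>* S\<^sub>1 + S\<^sub>3\<^sup>* S\<^sub>3) = 2\<close> once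
  \<open>S\<^sub>2 = -S\<^sub>1\<close> and \<open>S\<^sub>4 = -S\<^sub>3\<close>, and \<open>2\<close> can be cancelled.\<close>

lemma bigO_2_universal:
  "is_universal_star_algebra (bigO 2)
    (\<lambda>i::2. presented_class (bigO_relations 2) (S_generator (if i = 1 then 1 else 3))) relations_23"
proof -
  let ?i = "\<lambda>i::2. if i = 1 then 1 else 3 :: 4"
  let ?s = "signed_pair (gen 1) (gen 2) :: 4 \<Rightarrow> 2 free"
  interpret J: free_star_ideal "free_ideal relations_23" by (rule free_star_ideal_generated)
  interpret J': free_star_ideal "free_ideal (bigO_relations 2)" by (rule free_star_ideal_generated)
  have "J.half_isometry (gen 1) \<and> J.half_isometry (gen 2) \<and>
      J.congr (fstar (gen 1) * gen 1 + fstar (gen 2) * gen 2) 1"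
    using subst_relations_23_iff[OF J.free_star_ideal_axioms, of gen] free_ideal_generators[of relations_23]
    by (simp add: subst_gen_id)
  then have balanced: "J.balanced_isometries ?s"
    using J.balanced_signed_pair by blast
  have S: "J'.balanced_isometries S_generator"
    and opposite: "S_generator 1 + S_generator 2 \<in> free_ideal (bigO_relations 2)"
      "S_generator 3 + S_generator 4 \<in> free_ideal (bigO_relations 2)"
    using bigO_relations_iff[OF J'.free_star_ideal_axioms, of 2] free_ideal_generators[of "bigO_relations 2"]
    by simp_all
  have "J'.congr v (- u)" if "u + v \<in> free_ideal (bigO_relations 2)" for u v
    using that by (simp add: cong_mod_def add.commute)
  note neg = this[OF opposite(1)] this[OF opposite(2)]
  have images: "J'.congr (subst (\<lambda>g. S_generator (?i g)) (?s k)) (S_generator k)" for k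
    using exhaust_4[of k] J'.cong_sym[OF neg(1)] J'.cong_sym[OF neg(2)]
    by (elim disjE) (simp_all add: signed_pair_def subst_uminus)
  have square: "J'.congr (fstar v * v) (fstar u * u)" if "J'.congr v (- u)" for u v
    using J'.cong_mult[OF J'.cong_star[OF that] that] by (simp add: fstar_uminus)
  have half: "J'.half_isometry (S_generator r)" for r
    using S by (simp add: J'.balanced_isometries_def)
  have double: "fscale 2 (u + v - 1) = u + u + v + v - 2" for u v :: "(4 \<times> 4) free"
    by (simp add: fscale_2 right_diff_distrib distrib_left mult_2 add_ac)
  let ?p = "\<lambda>r. fstar (S_generator r) * S_generator r"
  have "J'.congr (?p 1 + ?p 2 + ?p 3 + ?p 4) (?p 1 + ?p 1 + ?p 3 + ?p 3)"
    by (intro J'.cong_add J'.cong_refl square neg)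
  moreover have "J'.congr (?p 1 + ?p 2 + ?p 3 + ?p 4) 2"
    using S by (simp add: J'.balanced_isometries_def sum_4)
  ultimately have "J'.congr (?p 1 + ?p 1 + ?p 3 + ?p 3) 2"
    using J'.cong_trans[OF J'.cong_sym] by blast
  then have "fscale 2 (?p 1 + ?p 3 - 1) \<in> free_ideal (bigO_relations 2)"
    by (simp add: cong_mod_def double)
  then have "J'.congr (?p 1 + ?p 3) 1"
    by (simp add: J'.scale_mem_iff cong_mod_def)
  then have "subst (\<lambda>g. S_generator (?i g)) ` relations_23 \<subseteq> free_ideal (bigO_relations 2)"
    using half by (simp add: subst_relations_23_iff[OF J'.free_star_ideal_axioms])
  moreover have "?s (?i g) = gen g" for g
    using exhaust_2[of g] by (auto simp: signed_pair_def)
  moreover have "?s 1 + ?s 2 \<in> free_ideal relations_23 \<and> ?s 3 + ?s 4 \<in> free_ideal relations_23"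
    by (simp add: signed_pair_def J.zero_mem)
  ultimately obtain \<phi> where \<phi>: "\<phi> \<in> star_iso (presented relations_23) (bigO 2)"
    "\<And>x. \<phi> (presented_class relations_23 x) =
      presented_class (bigO_relations 2) (subst (\<lambda>g. S_generator (?i g)) x)"
    using bigO_presentation[of 2 ?s ?i relations_23] balanced images by auto
  then show ?thesis
    unfolding is_universal_star_algebra_def by (intro bexI[OF _ \<phi>(1)]) simp
qed

lemma linear_extension_basis:
  "linear_extension E (M2_basis (M2_index a b)) = fscale (complex_of_real (sqrt 2)) (E a b)"
proof -
  have "linear_extension E (msmult c x) = fscale c (linear_extension E x)" for c x
    by (simp add: linear_extension_def msmult_def fscale_sum fscale_simps)
  then show ?thesis
    by (simp add: M2_basis_index linear_extension_matrix_unit)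
qed

lemma bigP_basis:
  assumes d: "d \<in> {1, 2, 3, 4}"
  shows "bigP d (M2_basis (M2_index a b)) = tensor_sum (bigO d) C4_basis
    (\<lambda>r. scale (bigO d) (1 / complex_of_real (sqrt 2))
      (presented_class (bigO_relations d) (units_of_isometry (S_generator r) a b)))"
proof -
  interpret J: free_star_ideal "free_ideal (bigO_relations d)" by (rule free_star_ideal_generated)
  let ?c = "presented_class (bigO_relations d)"
  let ?u = "\<lambda>r. units_of_isometry (S_generator r) a b"
  have units: "J.congr (coefficient r a b) (?u r)" for r
    using bigO_relations_iff[OF J.free_star_ideal_axioms d] free_ideal_generators[of "bigO_relations d"]
    by blast
  have scalar: "2 * (1 / complex_of_real (sqrt 2)) = complex_of_real (sqrt 2)"
    using sqrt_2_sqrt_2 by (simp add: field_simps)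
  show ?thesis
    unfolding vec_eq_iff
  proof (intro allI)
    fix p q
    have "tensor_sum (bigO d) C4_basis (\<lambda>r. scale (bigO d) (1 / complex_of_real (sqrt 2)) (?c (?u r))) $ p $ q =
        ?c (\<Sum>r\<in>UNIV. fscale (C4_basis r $ p $ q) (fscale (1 / complex_of_real (sqrt 2)) (?u r)))"
      by (simp add: tensor_sum_def bigO_def bigalois_def presented_class_simps presented_class_sum)
    also have "(\<Sum>r\<in>UNIV. fscale (C4_basis r $ p $ q) (fscale (1 / complex_of_real (sqrt 2)) (?u r))) =
        (\<Sum>r\<in>UNIV. if p = r then (if p = q then fscale (complex_of_real (sqrt 2)) (?u p) else 0) else 0)"
      by (intro sum.cong refl)
        (auto simp: C4_basis_def msmult_def matrix_unit_def fscale_simps scalar simp del: times_divide_eq_right)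
    also have "\<dots> = (if p = q then fscale (complex_of_real (sqrt 2)) (?u p) else 0)"
      by simp
    also have "?c \<dots> = ?c (if p = q then fscale (complex_of_real (sqrt 2)) (coefficient p a b) else 0)"
      unfolding presented_class_eq_iff using J.cong_sym[OF J.cong_scale[OF units]] by simp
    also have "\<dots> = bigP d (M2_basis (M2_index a b)) $ p $ q"
      by (simp add: bigP_def quantum_iso_def formal_map_component linear_extension_basis)
    finally show "bigP d (M2_basis (M2_index a b)) $ p $ q = tensor_sum (bigO d) C4_basis
        (\<lambda>r. scale (bigO d) (1 / complex_of_real (sqrt 2)) (?c (?u r))) $ p $ q" ..
  qed
qed

lemma coefficients_of_P_S_generator:
  assumes d: "d \<in> {1, 2, 3, 4}"
  shows "coefficients_of_P d (\<lambda>r. presented_class (bigO_relations d) (S_generator r))"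
proof -
  have "M2_index 1 1 = 1" "M2_index 1 2 = 2" "M2_index 2 1 = 3" "M2_index 2 2 = 4"
    by (simp_all add: M2_index_def)
  then show ?thesis
    using bigP_basis[OF d, of 1 1] bigP_basis[OF d, of 1 2] bigP_basis[OF d, of 2 1] bigP_basis[OF d, of 2 2]
    by (simp add: coefficients_of_P_def Let_def bigO_def bigalois_def presented_class_simps
        units_of_isometry_def)
qed

theorem proposition4p7:
  shows "bigO 1 = bigO 4 \<and> bigO 2 = bigO 3 \<and>
    (\<exists>S T.
       S ` UNIV \<subseteq> carrier (bigO 1) \<and>
       is_universal_star_algebra (bigO 1) S relations_14 \<and>
       (\<forall>d\<in>{1, 4}. coefficients_of_P d S) \<and>
       T ` UNIV \<subseteq> carrier (bigO 2) \<and>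
       is_universal_star_algebra (bigO 2) (\<lambda>i::2. if i = 1 then T 1 else T 3) relations_23 \<and>
       (\<forall>d\<in>{2, 3}. coefficients_of_P d T) \<and>
       (let J = star_ideal (bigO 1) {S 1 \<oplus>\<^bsub>bigO 1\<^esub> S 2, S 3 \<oplus>\<^bsub>bigO 1\<^esub> S 4}
        in \<exists>\<psi>\<in>star_iso (star_quotient (bigO 1) J) (bigO 2).
             \<forall>r. \<psi> (J +>\<^bsub>bigO 1\<^esub> S r) = T r))"
proof -
  define S where "S r = presented_class (bigO_relations 1) (S_generator r)" for r
  define T where "T r = presented_class (bigO_relations 2) (S_generator r)" for r
  have bigO: "bigO d = presented (bigO_relations d)" for d
    by (simp add: bigO_def bigalois_def)
  have class_14: "presented_class (bigO_relations 1) = presented_class (bigO_relations 4)"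
    unfolding presented_class_def bigO_ideal_1_4 ..
  have class_23: "presented_class (bigO_relations 2) = presented_class (bigO_relations 3)"
    unfolding presented_class_def bigO_ideal_2_3 ..
  have "bigO 1 = bigO 4" "bigO 2 = bigO 3"
    unfolding bigO presented_def bigO_ideal_1_4 bigO_ideal_2_3 by (rule refl)+
  moreover have "S ` UNIV \<subseteq> carrier (bigO 1)" "T ` UNIV \<subseteq> carrier (bigO 2)"
    unfolding S_def T_def bigO by (auto intro: presented_class_simps(1))
  moreover have "is_universal_star_algebra (bigO 1) S relations_14"
    unfolding S_def[abs_def] by (rule bigO_1_universal)
  moreover have "is_universal_star_algebra (bigO 2) (\<lambda>i::2. if i = 1 then T 1 else T 3) relations_23"
  proof -
    have "(\<lambda>i::2. if i = 1 then T 1 else T 3) =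
        (\<lambda>i. presented_class (bigO_relations 2) (S_generator (if i = 1 then 1 else 3)))"
      by (auto simp: fun_eq_iff T_def)
    then show ?thesis
      using bigO_2_universal by (simp only:)
  qed
  moreover have "\<forall>d\<in>{1, 4}. coefficients_of_P d S"
    using coefficients_of_P_S_generator[of 1] coefficients_of_P_S_generator[of 4]
    unfolding S_def[abs_def] class_14 by simp
  moreover have "\<forall>d\<in>{2, 3}. coefficients_of_P d T"
    using coefficients_of_P_S_generator[of 2] coefficients_of_P_S_generator[of 3]
    unfolding T_def[abs_def] class_23 by simp
  moreover have "let J = star_ideal (bigO 1) {S 1 \<oplus>\<^bsub>bigO 1\<^esub> S 2, S 3 \<oplus>\<^bsub>bigO 1\<^esub> S 4}
        in \<exists>\<psi>\<in>star_iso (star_quotient (bigO 1) J) (bigO 2).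
             \<forall>r. \<psi> (J +>\<^bsub>bigO 1\<^esub> S r) = T r"
    using quotient_of_presented[OF bigO_ideal_2]
    unfolding Let_def S_def T_def bigO presented_class_simps image_insert image_empty by blast
  ultimately show ?thesis
    by blast
qed

end
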